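(* For every integer $k\ge 3$, the polynomial $\Theta_k(X_1,\dots,X_k)\in\mathbb F_2[X_1,\dots,X_k]$ is absolutely irreducible, i.e., irreducible in $\overline{\mathbb F}_2[X_1,\dots,X_k]$, where $\overline{\mathbb F}_2$ is the algebraic closure of $\mathbb F_2$.
   Context: A partition of a positive integer is called a $2$-adic partition if all its parts are powers of $2$ (including $2^0=1$). For a positive integer $k$, let $\Lambda_k$ be the set of all $2$-adic partitions of $2^{k-1}$ with at most $k$ parts. For a partition $\lambda$ with at most $k$ parts, $m_\lambda(X_1,\dots,X_k)$ denotes the monomial symmetric polynomial associated with $\lambda$: the sum of all distinct monomials $X_1^{\alpha_1}\cdots X_k^{\alpha_k}$, where $(\alpha_1,\dots,\alpha_k)$ runs over the distinct permutations of $\lambda$ padded with zeros to length $k$. Define $$\Theta_k(X_1,\dots,X_k)=\sum_{\lambda\in\Lambda_k}m_\lambda(X_1,\dots,X_k),$$ treated as a polynomial over $\mathbb F_2$. It is homogeneous and symmetric of degree $2^{k-1}$. *)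

theory Defs
  imports
    "HOL-Library.Cardinality"
    "HOL-Library.Multiset"
    "HOL-Library.Poly_Mapping"
    "HOL-Library.Z2"
    "HOL-Algebra.Algebraic_Closure_Type"
begin

text \<open>
  A polynomial with coefficients in \<open>'a\<close> and one variable for each element of a finite type \<open>'n\<close>
  is a finitely supported map from exponent vectors \<open>\<alpha> :: 'n \<Rightarrow>\<^sub>0 nat\<close> to coefficients; the
  multiplication of \<^theory>\<open>HOL-Library.Poly_Mapping\<close> is the convolution product.  The number \<open>k\<close>
  of variables is \<open>CARD('n)\<close>.
\<close>

type_synonym ('n, 'a) mpoly = "('n \<Rightarrow>\<^sub>0 nat) \<Rightarrow>\<^sub>0 'a"

definition is_partition :: "nat multiset \<Rightarrow> nat \<Rightarrow> bool" where
  "is_partition \<rho> n \<longleftrightarrow> 0 \<notin># \<rho> \<and> sum_mset \<rho> = n"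

definition two_adic :: "nat multiset \<Rightarrow> bool" where
  "two_adic \<rho> \<longleftrightarrow> (\<forall>p \<in># \<rho>. \<exists>i. p = 2 ^ i)"

definition Lambda :: "nat \<Rightarrow> nat multiset set" where
  "Lambda k = {\<rho>. is_partition \<rho> (2 ^ (k - 1)) \<and> two_adic \<rho> \<and> size \<rho> \<le> k}"

text \<open>
  An exponent vector is a permutation of \<open>\<rho>\<close> padded with zeros to length \<open>CARD('n)\<close> iff its
  multiset of entries is \<open>\<rho>\<close> plus the padding.  Only meaningful if \<open>size \<rho> \<le> CARD('n)\<close>
  (otherwise the set is empty).
\<close>

definition perms_padded :: "nat multiset \<Rightarrow> ('n::finite \<Rightarrow>\<^sub>0 nat) set" where
  "perms_padded \<rho> =
     {\<alpha>. image_mset (Poly_Mapping.lookup \<alpha>) (mset_set UNIV) = \<rho> + replicate_mset (CARD('n) - size \<rho>) 0}"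

definition monomial_symmetric :: "nat multiset \<Rightarrow> ('n::finite, 'a::comm_ring_1) mpoly" where
  "monomial_symmetric \<rho> = (\<Sum>\<alpha>\<in>perms_padded \<rho>. Poly_Mapping.single \<alpha> 1)"

definition Theta :: "('n::finite, bit) mpoly" where
  "Theta = (\<Sum>\<rho>\<in>Lambda CARD('n). monomial_symmetric \<rho>)"

text \<open>
  \<^const>\<open>to_ac\<close> is the embedding of a field into its algebraic closure.  The name
  \<open>irreducible\<close> alone would also match the notion of \<^theory>\<open>HOL-Algebra.Divisibility\<close>.
\<close>

definition absolutely_irreducible :: "('n::finite, 'a::field) mpoly \<Rightarrow> bool" where
  "absolutely_irreducible p \<longleftrightarrow> Factorial_Ring.irreducible (Poly_Mapping.map to_ac p)"

text \<open>Both index sets are finite, so the sums above are not the default value \<open>0\<close>.\<close>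

lemma finite_Lambda: "finite (Lambda k)"
proof -
  have "Lambda k \<subseteq> mset ` {xs. set xs \<subseteq> {..2 ^ (k - 1)} \<and> length xs \<le> k}"
  proof
    fix \<rho> assume l: "\<rho> \<in> Lambda k"
    obtain xs where xs: "mset xs = \<rho>" using ex_mset by blast
    have "x \<le> 2 ^ (k - 1)" if "x \<in> set xs" for x
    proof -
      have "x \<in># \<rho>" using that xs by auto
      then obtain M where "\<rho> = add_mset x M" by (meson mset_add)
      then show ?thesis using l by (auto simp: Lambda_def is_partition_def)
    qed
    moreover have "length xs \<le> k" using l xs by (auto simp: Lambda_def)
    ultimately show "\<rho> \<in> mset ` {xs. set xs \<subseteq> {..2 ^ (k - 1)} \<and> length xs \<le> k}"
      using xs by blast
  qed
  then show ?thesis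
    by (rule finite_subset) (intro finite_imageI finite_lists_length_le, simp)
qed

lemma finite_perms_padded: "finite (perms_padded \<rho> :: ('n::finite \<Rightarrow>\<^sub>0 nat) set)"
proof -
  let ?S = "insert 0 (set_mset \<rho>)"
  have "Poly_Mapping.lookup ` (perms_padded \<rho> :: ('n \<Rightarrow>\<^sub>0 nat) set) \<subseteq> (UNIV \<rightarrow>\<^sub>E ?S)"
  proof
    fix f :: "'n \<Rightarrow> nat" assume "f \<in> Poly_Mapping.lookup ` perms_padded \<rho>"
    then obtain \<alpha> :: "'n \<Rightarrow>\<^sub>0 nat" where a: "f = Poly_Mapping.lookup \<alpha>" "\<alpha> \<in> perms_padded \<rho>" by blast
    have "set_mset (image_mset (Poly_Mapping.lookup \<alpha>) (mset_set UNIV)) \<subseteq> ?S"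
      using a(2) by (auto simp: perms_padded_def)
    then show "f \<in> UNIV \<rightarrow>\<^sub>E ?S" using a(1) by auto
  qed
  moreover have "finite ((UNIV :: 'n set) \<rightarrow>\<^sub>E ?S)" by (intro finite_PiE) auto
  ultimately have "finite (Poly_Mapping.lookup ` (perms_padded \<rho> :: ('n \<Rightarrow>\<^sub>0 nat) set))"
    by (rule finite_subset)
  then show ?thesis by (rule finite_imageD) (auto simp: inj_on_def lookup_inject)
qed

end

theory Submission
  imports Defs "HOL-Computational_Algebra.Polynomial_Factorial"
begin

text \<open>
  Single out one variable \<open>Y\<close>, let \<open>x\<^sub>1, \<dots>, x\<^sub>n\<close> be the other \<open>n = k - 1\<close> variables and \<open>V\<close> their
  span over the field with two elements.  The polynomial \<open>D\<^sub>V(Y) = \<Prod>v\<in>V. (Y + v)\<close> is additive, of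
  degree \<open>2 ^ n\<close>.  The key identity is \<open>\<Theta>\<^sub>k = D\<^sub>V(Y) + c\<^sub>V\<^sup>2\<close>, where \<open>c\<^sub>V\<close> is the coefficient of
  \<open>Y\<close> to the power \<open>2 ^ (n - 1)\<close> in \<open>D\<^sub>V\<close> (lemma \<open>two_adic_sum_eq_subgroup_poly\<close>); in other words
  \<open>\<Theta>\<^sub>k\<close> is the Dickson invariant of degree \<open>2 ^ (k - 1)\<close>.  It holds because the part of \<open>\<Theta>\<^sub>k\<close> that
  depends on \<open>Y\<close> contains only the powers \<open>Y ^ 2 ^ i\<close>, hence is additive in \<open>Y\<close>, and vanishes when
  \<open>Y\<close> is set to one of the \<open>x\<^sub>j\<close>: the terms then cancel in pairs, up to those whose sum is \<open>\<Theta>\<^sub>n\<^sup>2\<close>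
  (\<open>two_adic_sum_repeated\<close>, \<open>two_adic_sum_square\<close>; both rest on the count of summands in
  \<open>exponents_no_one\<close>).

  A polynomial \<open>D\<^sub>V(Y) + a\<close> over a field of characteristic 2 is like an Artin-Schreier polynomial: the
  group \<open>V\<close> acts on its factors by translation of \<open>Y\<close>.  If \<open>f\<close> is a proper irreducible factor, its
  stabiliser lies in a subgroup \<open>U\<close> of index 2, and the product of the \<open>U\<close>-translates of \<open>f\<close> is a
  polynomial in \<open>Z = D\<^sub>U(Y)\<close>.  As \<open>D\<^sub>V(Y) + a\<close> itself is the quadratic \<open>Z\<^sup>2 + c Z + a\<close> with
  \<open>c = D\<^sub>U(v)\<close>, \<open>v \<in> V - U\<close>, a factorisation is possible only if such a quadratic has a root
  (\<open>irreducible_subgroup_poly_plus_const\<close>).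

  For \<open>a = c\<^sub>V\<^sup>2\<close> one has \<open>c\<^sub>V = b\<^sup>2 + c\<close> with \<open>b = c\<^sub>U\<close>, and the substitution \<open>z = w + b\<^sup>2\<close> turns the
  quadratic into \<open>w\<^sup>2 + c w + c (b\<^sup>2 + c) = 0\<close>.  This has no solution if there is a place at which \<open>c\<close>
  has order 1 and \<open>b\<close> does not vanish.  Such places exist after the specialisation
  \<open>x\<^sub>j = s\<^sup>j (t + s\<^sup>j)\<close> in \<open>K[s][t]\<close>: for a generator \<open>x\<^sub>i\<close> outside \<open>U\<close> the place \<open>t = s\<^sup>i\<close> does it
  (\<open>no_root_fract\<close>).  The non-vanishing of \<open>b\<close> requires \<open>n \<ge> 2\<close>, which is where \<open>k \<ge> 3\<close> enters.

  Finally, a factor of the homogeneous polynomial \<open>\<Theta>\<^sub>k\<close> whose specialisation is constant in \<open>Y\<close> is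
  itself constant: total degrees of the two factors add up to \<open>2 ^ (k - 1)\<close>, and this is also the
  degree in \<open>Y\<close> of the specialised product.
\<close>

section \<open>Additive polynomials of finite subgroups\<close>

lemma add_self_CHAR_2:
  assumes "CHAR('a::ring_1) = 2"
  shows "x + x = (0 :: 'a)"
  using minus_CHAR_2[OF assms, of x x] by simp

lemma add_eq_0_CHAR_2:
  assumes "CHAR('a::ring_1) = 2"
  shows "x + y = (0 :: 'a) \<longleftrightarrow> x = y"
  using minus_CHAR_2[OF assms, of x y] by (metis right_minus_eq)

text \<open>
  In characteristic 2 closure under addition already gives a subgroup, as every element is its own
  inverse.
\<close>

definition fin_subgroup :: "'a::comm_ring_1 set \<Rightarrow> bool" where
  "fin_subgroup U \<longleftrightarrow> finite U \<and> 0 \<in> U \<and> (\<forall>u\<in>U. \<forall>v\<in>U. u + v \<in> U)"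

definition subgroup_poly :: "'a::comm_ring_1 set \<Rightarrow> 'a poly" where
  "subgroup_poly U = (\<Prod>u\<in>U. [:u, 1:])"

abbreviation shift :: "'a::comm_ring_1 \<Rightarrow> 'a poly \<Rightarrow> 'a poly" where
  "shift v p \<equiv> p \<circ>\<^sub>p [:v, 1:]"

lemma shift_shift: "shift u (shift v p) = shift (u + v) p"
  by (simp add: pcompose_pCons add.commute flip: pcompose_assoc)

lemma shift_0: "shift 0 p = p"
  by simp

lemma degree_shift: "degree (shift (v::'a::idom) p) = degree p"
  by (simp add: degree_pcompose)

lemma lead_coeff_shift: "lead_coeff (shift (v::'a::idom) p) = lead_coeff p"
  by (simp add: lead_coeff_comp)

lemma card_fin_subgroup_pos: "fin_subgroup U \<Longrightarrow> card U > 0"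
  by (auto simp: fin_subgroup_def card_gt_0_iff)

lemma degree_subgroup_poly: "degree (subgroup_poly U :: 'a::idom poly) = card U"
  unfolding subgroup_poly_def by (subst degree_prod_eq_sum_degree) auto

lemma lead_coeff_subgroup_poly: "lead_coeff (subgroup_poly U :: 'a::idom poly) = 1"
  unfolding subgroup_poly_def by (simp add: lead_coeff_prod)

lemma poly_subgroup_poly: "poly (subgroup_poly U) x = (\<Prod>u\<in>U. u + x)"
  by (simp add: subgroup_poly_def poly_prod)

lemma bij_translate:
  assumes "CHAR('a::comm_ring_1) = 2" "fin_subgroup U" "u \<in> U"
  shows "bij_betw ((+) (u::'a)) U U"
proof (rule bij_betw_byWitness[where f' = "(+) u"])
  have "u + (u + a) = a" for a
    using add_self_CHAR_2[OF assms(1), of u] by (simp flip: add.assoc)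
  then show "\<forall>a\<in>U. u + (u + a) = a" "\<forall>a\<in>U. u + (u + a) = a" by blast+
qed (use assms in \<open>auto simp: fin_subgroup_def\<close>)

lemma poly_subgroup_poly_root:
  assumes "CHAR('a::comm_ring_1) = 2" "fin_subgroup U" "u \<in> U"
  shows "poly (subgroup_poly U) (u::'a) = 0"
proof -
  have "(\<Prod>w\<in>U. w + u) = 0" 
    using assms add_self_CHAR_2[OF assms(1), of u]
    by (intro prod_zero) (unfold fin_subgroup_def, blast+)
  then show ?thesis by (simp add: poly_subgroup_poly)
qed

text \<open>
  Additivity of \<open>D\<^sub>U\<close>: both \<open>D\<^sub>U(Y + v) - D\<^sub>U(Y)\<close> and the constant \<open>D\<^sub>U(v)\<close> have degree less than
  \<open>card U\<close>, and they agree at the \<open>card U\<close> points of \<open>U\<close> because translation by \<open>u \<in> U\<close> permutes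
  the factors of \<open>D\<^sub>U(v + u)\<close>.
\<close>

lemma shift_subgroup_poly:
  assumes "CHAR('a::idom) = 2" "fin_subgroup U"
  shows "shift v (subgroup_poly U) = subgroup_poly U + [:poly (subgroup_poly U) (v::'a):]"
proof -
  let ?D = "subgroup_poly U"
  have deg: "degree ?D = card U" "degree (shift v ?D) = card U"
    by (simp_all add: degree_subgroup_poly degree_pcompose)
  have pos: "card U > 0" by (rule card_fin_subgroup_pos) fact
  have "shift v ?D - ?D = [:poly ?D v:]"
  proof (rule poly_eqI_degree)
    fix u assume u: "u \<in> U"
    have "poly (shift v ?D) u = (\<Prod>w\<in>U. w + (v + u))"
      by (simp add: poly_pcompose poly_subgroup_poly)
    also have "\<dots> = (\<Prod>w\<in>U. (u + w) + v)" by (simp add: add_ac)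
    also have "\<dots> = (\<Prod>w\<in>U. w + v)"
      using bij_translate[OF assms u] by (rule prod.reindex_bij_betw)
    also have "\<dots> = poly ?D v" by (simp add: poly_subgroup_poly)
    finally have "poly (shift v ?D) u = poly ?D v" .
    then show "poly (shift v ?D - ?D) u = poly [:poly ?D v:] u"
      using poly_subgroup_poly_root[OF assms u] by simp
  next
    have "coeff (shift v ?D - ?D) (card U) = 0"
      using lead_coeff_shift[where v = v and p = ?D] deg by simp
    moreover have "degree (shift v ?D - ?D) \<le> card U"
      using deg degree_diff_le by (metis order_refl)
    ultimately show "degree (shift v ?D - ?D) < card U"
      using pos by (metis degree_0 le_neq_implies_less leading_coeff_0_iff)
  qed (use pos in auto)
  then show ?thesis by (simp add: diff_eq_eq add.commute)
qed

corollary shift_subgroup_poly_mem: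
  assumes "CHAR('a::idom) = 2" "fin_subgroup U" "(u::'a) \<in> U"
  shows "shift u (subgroup_poly U) = subgroup_poly U"
  using shift_subgroup_poly[OF assms(1,2)] poly_subgroup_poly_root[OF assms] by simp

text \<open>
  Split the product over \<open>V\<close> into the two cosets of \<open>U\<close>; the factor of the coset \<open>v + U\<close> is
  \<open>D\<^sub>U(Y + v) = D\<^sub>U(Y) + D\<^sub>U(v)\<close>.
\<close>

lemma subgroup_poly_extend:
  fixes U :: "'a::idom set"
  assumes char: "CHAR('a) = 2" and U: "fin_subgroup U" and v: "v \<notin> U" and V: "V = U \<union> (+) v ` U"
  shows "subgroup_poly V = subgroup_poly U ^ 2 + smult (poly (subgroup_poly U) v) (subgroup_poly U)"
proof -
  have disj: "U \<inter> (+) v ` U = {}"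
  proof -
    { fix u w assume "u \<in> U" "w \<in> U" "u = v + w"
      then have "u + w = v" using add_self_CHAR_2[OF char, of w] by (simp add: add.assoc)
      then have "v \<in> U" using U \<open>u \<in> U\<close> \<open>w \<in> U\<close> by (auto simp: fin_subgroup_def) }
    then show ?thesis using v by auto
  qed
  have "subgroup_poly V = subgroup_poly U * (\<Prod>u\<in>(+) v ` U. [:u, 1:])"
    unfolding subgroup_poly_def V using disj U by (subst prod.union_disjoint) (auto simp: fin_subgroup_def)
  also have "(\<Prod>u\<in>(+) v ` U. [:u, 1:]) = shift v (subgroup_poly U)"
    by (subst prod.reindex) (simp_all add: subgroup_poly_def pcompose_prod pcompose_pCons add.commute)
  also have "\<dots> = subgroup_poly U + [:poly (subgroup_poly U) v:]"
    by (rule shift_subgroup_poly) fact+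
  finally show ?thesis by (simp add: power2_eq_square algebra_simps)
qed

lemma coeff_square_CHAR_2:
  fixes p :: "'a::idom poly"
  assumes "CHAR('a) = 2"
  shows "coeff (p ^ 2) (2 * n) = coeff p n ^ 2"
proof -
  have "p ^ 2 = (\<Sum>i\<le>degree p. monom (coeff p i) i) ^ 2" by (simp add: poly_as_sum_of_monoms)
  also have "\<dots> = (\<Sum>i\<le>degree p. monom (coeff p i ^ 2) (2 * i))"
    by (subst freshmans_dream_sum) (use assms in \<open>auto simp: monom_power mult.commute\<close>)
  finally have "coeff (p ^ 2) (2 * n) = (\<Sum>i\<le>degree p. if i = n then coeff p i ^ 2 else 0)"
    by (simp add: coeff_sum)
  also have "\<dots> = coeff p n ^ 2"
    by (auto simp: coeff_eq_0)
  finally show ?thesis .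
qed

text \<open>
  If \<open>V\<close> is generated by \<open>n\<close> independent elements, this is the coefficient of \<open>Y ^ 2 ^ (n - 1)\<close> in
  \<open>D\<^sub>V\<close>, the Dickson invariant of lowest degree of \<open>V\<close>.
\<close>

definition mid_coeff :: "'a::comm_ring_1 set \<Rightarrow> 'a" where
  "mid_coeff U = coeff (subgroup_poly U) (card U div 2)"

lemma card_extend:
  fixes U :: "'a::idom set"
  assumes char: "CHAR('a) = 2" and U: "fin_subgroup U" and v: "v \<notin> U" and V: "V = U \<union> (+) v ` U"
  shows "card V = 2 * card U"
proof -
  have "card V = degree (subgroup_poly V)" by (simp add: degree_subgroup_poly)
  also have "subgroup_poly V = subgroup_poly U * shift v (subgroup_poly U)"
    by (subst subgroup_poly_extend[OF assms], subst shift_subgroup_poly[OF char U])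
      (simp add: power2_eq_square algebra_simps)
  also have "degree \<dots> = 2 * card U"
    using lead_coeff_subgroup_poly[of U] lead_coeff_shift[where v = v and p = "subgroup_poly U"]
    by (subst degree_mult_eq) (auto simp: degree_subgroup_poly degree_pcompose)
  finally show ?thesis .
qed

text \<open>
  The coefficient of \<open>Y ^ card U\<close> in \<open>D\<^sub>V = D\<^sub>U\<^sup>2 + c D\<^sub>U\<close>.  It is \<open>Y ^ (card U div 2)\<close> in \<open>D\<^sub>U\<close> that
  contributes to the square, so \<open>card U\<close> has to be even, i.e. \<open>U\<close> non-trivial.
\<close>

lemma mid_coeff_extend:
  fixes U :: "'a::idom set"
  assumes char: "CHAR('a) = 2" and U: "fin_subgroup U" and v: "v \<notin> U" and V: "V = U \<union> (+) v ` U"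
    and ev: "even (card U)"
  shows "mid_coeff V = mid_coeff U ^ 2 + poly (subgroup_poly U) v"
proof -
  have "mid_coeff V = coeff (subgroup_poly U ^ 2) (card U) + poly (subgroup_poly U) v"
    using card_extend[OF assms(1-4)] subgroup_poly_extend[OF assms(1-4)] lead_coeff_subgroup_poly[of U]
    by (simp add: mid_coeff_def degree_subgroup_poly)
  then show ?thesis using coeff_square_CHAR_2[OF char, of "subgroup_poly U" "card U div 2"] ev
    by (simp add: mid_coeff_def)
qed

lemma prod_linear_dvd:
  fixes p :: "'a::idom poly"
  assumes "CHAR('a) = 2" "finite T" "\<And>u. u \<in> T \<Longrightarrow> poly p u = 0"
  shows "(\<Prod>u\<in>T. [:u, 1:]) dvd p"
  using assms(2,3)
proof (induction T rule: finite_induct)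
  case (insert u T)
  then obtain q where q: "p = (\<Prod>u\<in>T. [:u, 1:]) * q" by (auto elim: dvdE)
  have "poly (\<Prod>u\<in>T. [:u, 1:]) u \<noteq> 0"
    using insert.hyps add_eq_0_CHAR_2[OF assms(1)] by (auto simp: poly_prod)
  then have "poly q u = 0" using insert.prems[of u] q by auto
  then have "[:u, 1:] dvd q" using uminus_CHAR_2[OF assms(1), of u] by (simp add: poly_eq_0_iff_dvd)
  then show ?case using insert.hyps q
    by (metis mult.commute mult_dvd_mono dvd_refl prod.insert)
qed auto

text \<open>
  A \<open>U\<close>-invariant polynomial \<open>p\<close> takes the value \<open>p(0)\<close> on all of \<open>U\<close>, so \<open>D\<^sub>U\<close> divides
  \<open>p - p(0)\<close>; the quotient is again invariant and has smaller degree.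
\<close>

lemma invariant_imp_pcompose:
  fixes p :: "'a::idom poly"
  assumes char: "CHAR('a) = 2" and U: "fin_subgroup U" and "\<And>u. u \<in> U \<Longrightarrow> shift u p = p"
  shows "\<exists>h. p = h \<circ>\<^sub>p subgroup_poly U"
  using assms(3)
proof (induction "degree p" arbitrary: p rule: less_induct)
  case less
  let ?D = "subgroup_poly U"
  have D: "degree ?D = card U" "card U > 0" "?D \<noteq> 0"
    using card_fin_subgroup_pos[OF U] lead_coeff_subgroup_poly[of U] by (auto simp: degree_subgroup_poly)
  have "?D dvd p - [:poly p 0:]" unfolding subgroup_poly_def
  proof (rule prod_linear_dvd[OF char])
    fix u assume "u \<in> U"
    then have "poly (shift u p) 0 = poly p 0" by (simp add: less.prems)
    then show "poly (p - [:poly p 0:]) u = 0" by (simp add: poly_pcompose)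
  qed (use U in \<open>auto simp: fin_subgroup_def\<close>)
  then obtain q where q: "p - [:poly p 0:] = ?D * q" by (elim dvdE)
  have p: "p = [:poly p 0:] + ?D * q" using q by (simp add: algebra_simps)
  show ?case
  proof (cases "q = 0")
    case True
    then have "p = [:poly p 0:] \<circ>\<^sub>p ?D" using p by (metis add.right_neutral mult_zero_right pcompose_const)
    then show ?thesis by blast
  next
    case False
    have "degree (p - [:poly p 0:]) = card U + degree q"
      using q D False by (simp add: degree_mult_eq)
    moreover have "degree (p - [:poly p 0:]) \<le> degree p"
      by (rule degree_diff_le) auto
    ultimately have "degree q < degree p" using D by simp
    moreover have "shift u q = q" if u: "u \<in> U" for u
    proof -
      have "?D * shift u q = shift u (?D * q)"
        using shift_subgroup_poly_mem[OF char U u] by (simp add: pcompose_mult)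
      also have "\<dots> = ?D * q"
        by (simp flip: q add: pcompose_diff less.prems[OF u])
      finally show ?thesis using D by simp
    qed
    ultimately obtain h where "q = h \<circ>\<^sub>p ?D" using less.hyps by blast
    then have "p = pCons (poly p 0) h \<circ>\<^sub>p ?D"
      using p by (simp add: pcompose_pCons)
    then show ?thesis by blast
  qed
qed

section \<open>An irreducibility criterion of Artin-Schreier type\<close>

lemma irreducible_factor_exists:
  fixes p :: "'a::field poly"
  assumes "degree p > 0"
  obtains f where "Factorial_Ring.irreducible f" "lead_coeff f = 1" "f dvd p"
proof -
  define Q where "Q = (\<lambda>f. f dvd p \<and> degree f > 0)"
  have "Q p" using assms by (simp add: Q_def)
  then obtain f where f: "Q f" and min: "\<And>g. Q g \<Longrightarrow> degree f \<le> degree g"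
    using ex_has_least_nat[of Q p degree] by blast
  then have f0: "f \<noteq> 0" by (auto simp: Q_def)
  define g where "g = smult (inverse (lead_coeff f)) f"
  have g: "g dvd f" "f dvd g" "degree g = degree f" "g \<noteq> 0" "lead_coeff g = 1"
    using f0 by (auto simp: g_def smult_dvd_iff dvd_smult)
  have "Factorial_Ring.irreducible g"
  proof (rule irreducibleI)
    show "\<not> g dvd 1" using g f by (auto simp: Q_def is_unit_iff_degree)
    fix a b assume ab: "g = a * b"
    then have nz: "a \<noteq> 0" "b \<noteq> 0" using g by auto
    have "a dvd p" using ab g f unfolding Q_def by (meson dvd_trans dvd_triv_left)
    show "a dvd 1 \<or> b dvd 1"
    proof (cases "degree a = 0")
      case False
      then have "degree f \<le> degree a" using min \<open>a dvd p\<close> by (auto simp: Q_def)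
      moreover have "degree f = degree a + degree b" using ab g(3) nz by (simp add: degree_mult_eq)
      ultimately show ?thesis using nz by (simp add: is_unit_iff_degree)
    qed (use nz in \<open>simp add: is_unit_iff_degree\<close>)
  qed (use g in auto)
  moreover have "g dvd p" using g f by (auto simp: Q_def intro: dvd_trans)
  ultimately show ?thesis using that g by blast
qed

text \<open>
  Dividing \<open>p\<close> by \<open>g\<close> with remainder and substituting \<open>d\<close> leaves a remainder of too small degree.
\<close>

lemma pcompose_dvd_pcompose_imp:
  fixes g p :: "'a::field poly"
  assumes "degree d > 0" "g \<circ>\<^sub>p d dvd p \<circ>\<^sub>p d"
  shows "g dvd p"
proof (cases "g = 0")
  case True
  then show ?thesis using assms by (auto simp: pcompose_eq_0_iff)
next
  case False
  have "p \<circ>\<^sub>p d = (g \<circ>\<^sub>p d) * ((p div g) \<circ>\<^sub>p d) + (p mod g) \<circ>\<^sub>p d"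
    by (metis mult_div_mod_eq pcompose_add pcompose_mult)
  then have dvd: "g \<circ>\<^sub>p d dvd (p mod g) \<circ>\<^sub>p d"
    using assms(2) by (metis dvd_add_right_iff dvd_triv_left)
  have "p mod g = 0"
  proof (rule ccontr)
    assume nz: "p mod g \<noteq> 0"
    then have "(p mod g) \<circ>\<^sub>p d \<noteq> 0" using assms(1) by (auto simp: pcompose_eq_0_iff)
    then have "degree (g \<circ>\<^sub>p d) \<le> degree ((p mod g) \<circ>\<^sub>p d)" using dvd by (rule dvd_imp_degree_le[rotated])
    then have "degree g \<le> degree (p mod g)" using assms(1) by (simp add: degree_pcompose)
    then show False using degree_mod_less[OF False, of p] nz by simp
  qed
  then show ?thesis by auto
qed

lemma pcompose_power_left: "(p ^ n) \<circ>\<^sub>p d = (p \<circ>\<^sub>p d) ^ n"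
  by (induction n) (simp_all add: pcompose_mult pcompose_1)

lemma irreducible_quadratic:
  fixes q :: "'a::field poly"
  assumes "degree q = 2" "\<And>z. poly q z \<noteq> 0"
  shows "Factorial_Ring.irreducible q"
proof (rule irreducibleI)
  show "q \<noteq> 0" using assms by auto
  then show "\<not> q dvd 1" using assms by (simp add: is_unit_iff_degree)
  fix a b assume q: "q = a * b"
  with \<open>q \<noteq> 0\<close> have nz: "a \<noteq> 0" "b \<noteq> 0" by auto
  have no1: "degree r \<noteq> 1" if "r dvd q" for r
  proof
    assume "degree r = 1"
    then obtain u w where r: "r = [:u, w:]" "w \<noteq> 0"
      by (metis degree1_coeffs)
    then have "poly r (- u / w) = 0" by simp
    then show False using assms(2) \<open>r dvd q\<close> by (metis dvdE mult_zero_left poly_mult)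
  qed
  have "degree a + degree b = 2" using assms(1) q nz by (simp add: degree_mult_eq)
  moreover have "degree a \<noteq> 1" using no1 q by simp
  ultimately have "degree a = 0 \<or> degree b = 0" by linarith
  then show "a dvd 1 \<or> b dvd 1" using nz by (simp add: is_unit_iff_degree)
qed

lemma irreducible_dvd_of_dvd_power:
  fixes q h :: "'a::field poly"
  assumes "Factorial_Ring.irreducible q" "h dvd q ^ N" "degree h > 0"
  shows "q dvd h"
proof -
  obtain f where f: "Factorial_Ring.irreducible f" "f dvd h"
    using irreducible_factor_exists[OF assms(3)] by blast
  then have "f dvd q ^ N" using assms(2) dvd_trans by blast
  then have "f dvd q" using f(1) field_poly_irreducible_imp_prime prime_elem_dvd_power by blast
  then obtain k where k: "q = f * k" by (elim dvdE)
  have "k dvd 1" using irreducibleD[OF assms(1) k] f(1) by (auto simp: irreducible_def)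
  then have "q dvd f" using k by (simp add: mult_unit_dvd_iff)
  then show ?thesis using f(2) dvd_trans by blast
qed

lemma prime_elem_dvd_prodE:
  assumes "finite U" "prime_elem p" "p dvd prod g U"
  shows "\<exists>u\<in>U. p dvd g u"
  using assms
  by (induction U rule: finite_induct) (auto simp: prime_elem_dvd_mult_iff prime_elem_not_unit)

lemma shift_dvd_shift:
  assumes "f dvd g"
  shows "shift v f dvd shift v g"
  using assms by (auto simp: pcompose_mult elim!: dvdE)

lemma irreducible_shift:
  fixes f :: "'a::field poly"
  assumes char: "CHAR('a) = 2" and f: "Factorial_Ring.irreducible f"
  shows "Factorial_Ring.irreducible (shift v f)"
proof (rule irreducibleI)
  have inv: "shift v (shift v p) = p" for p
    by (simp only: shift_shift add_self_CHAR_2[OF char] shift_0)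
  have f0: "f \<noteq> 0" "\<not> f dvd 1" using f by (auto simp: irreducible_def)
  show "shift v f \<noteq> 0" using f0 by (auto simp: pcompose_eq_0_iff)
  then show "\<not> shift v f dvd 1" using f0 by (simp add: is_unit_iff_degree degree_shift)
  fix a b assume ab: "shift v f = a * b"
  then have nz: "a \<noteq> 0" "b \<noteq> 0" using \<open>shift v f \<noteq> 0\<close> by auto
  have "f = shift v a * shift v b" using ab inv[of f] by (simp add: pcompose_mult)
  then have "shift v a dvd 1 \<or> shift v b dvd 1" using f by (rule irreducibleD[rotated])
  moreover have "x dvd 1" if "shift v x dvd 1" for x
    using shift_dvd_shift[OF that, of v] inv[of x] by (simp add: pcompose_1)
  ultimately show "a dvd 1 \<or> b dvd 1" by blast
qed

text \<open>
  A maximal proper subgroup containing \<open>W\<close> has index 2: adjoining one more element \<open>v\<close> adds just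
  the coset \<open>v + U\<close>.
\<close>

lemma exists_hyperplane:
  fixes V :: "'a::comm_ring_1 set"
  assumes char: "CHAR('a) = 2" and V: "fin_subgroup V" and W: "fin_subgroup W" "W \<subset> V"
  obtains U v where "fin_subgroup U" "W \<subseteq> U" "v \<in> V" "v \<notin> U" "V = U \<union> (+) v ` U"
proof -
  define S where "S = {U. fin_subgroup U \<and> W \<subseteq> U \<and> U \<subset> V}"
  have "finite V" using V by (simp add: fin_subgroup_def)
  then have "finite S" by (intro finite_subset[of S "Pow V"]) (auto simp: S_def)
  moreover have "W \<in> S" using W by (auto simp: S_def)
  ultimately obtain U where U: "U \<in> S" and max: "\<forall>U'\<in>S. U \<subseteq> U' \<longrightarrow> U = U'"
    using finite_has_maximal2[of S W] by metis
  obtain v where v: "v \<in> V" "v \<notin> U" using U by (auto simp: S_def)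
  let ?U' = "U \<union> (+) v ` U"
  have Us: "fin_subgroup U" "U \<subseteq> V" "W \<subseteq> U" using U by (auto simp: S_def)
  have vv: "v + v = 0" by (rule add_self_CHAR_2[OF char])
  have 1: "fin_subgroup ?U'" unfolding fin_subgroup_def
  proof (intro conjI ballI)
    show "finite ?U'" "0 \<in> ?U'" using Us by (auto simp: fin_subgroup_def)
    have cl: "a + b \<in> U" if "a \<in> U" "b \<in> U" for a b using Us that by (auto simp: fin_subgroup_def)
    fix x y assume "x \<in> ?U'" "y \<in> ?U'"
    then consider "x \<in> U" "y \<in> U" | b where "x \<in> U" "b \<in> U" "y = v + b"
      | a where "a \<in> U" "x = v + a" "y \<in> U" | a b where "a \<in> U" "x = v + a" "b \<in> U" "y = v + b" by blast
    then show "x + y \<in> ?U'"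
    proof cases
      case 2 then have "x + y = v + (x + b)" by simp
      then show ?thesis using cl[of x b] 2 by blast
    next
      case 3 then have "x + y = v + (a + y)" by simp
      then show ?thesis using cl[of a y] 3 by blast
    next
      case 4 then have "x + y = (v + v) + (a + b)" by (simp only: add_ac)
      then show ?thesis using cl[of a b] 4 vv by auto
    qed (use cl in auto)
  qed
  have 2: "?U' \<subseteq> V" using Us v V by (auto simp: fin_subgroup_def)
  have "v + 0 \<in> ?U'" using Us unfolding fin_subgroup_def by blast
  then have "?U' \<noteq> U" using v by auto
  then have "?U' \<notin> S" using max by (metis Un_upper1)
  then have "V = ?U'" using 1 2 Us by (auto simp: S_def)
  then show ?thesis using that[OF Us(1,3) v] by blast
qed

text \<open>
  The stabiliser \<open>W\<close> of an irreducible factor \<open>f\<close> is either \<open>V\<close>, and then \<open>f\<close> is a polynomial in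
  \<open>D\<^sub>V\<close> and too large to be a proper factor, or it lies in a subgroup \<open>U\<close> of index 2.  In the second
  case the norm \<open>N\<close> of \<open>f\<close> with respect to \<open>U\<close> is a polynomial in \<open>D\<^sub>U\<close>, and so is
  \<open>P = D\<^sub>V + a\<close>, as the quadratic \<open>q\<close> in \<open>D\<^sub>U\<close>.  Irreducibility of \<open>q\<close> makes \<open>P\<close> divide \<open>N\<close>.
  Hence every \<open>V\<close>-translate of \<open>f\<close>, being a factor of \<open>P\<close>, is already a \<open>U\<close>-translate, which
  contradicts \<open>W \<subseteq> U\<close>.
\<close>

theorem irreducible_subgroup_poly_plus_const:
  fixes V :: "'a::field set"
  assumes char: "CHAR('a) = 2" and V: "fin_subgroup V"
    and no_root: "\<And>U v z. \<lbrakk>fin_subgroup U; v \<in> V; v \<notin> U; V = U \<union> (+) v ` U\<rbrakk>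
                    \<Longrightarrow> z ^ 2 + poly (subgroup_poly U) v * z + a \<noteq> 0"
  shows "Factorial_Ring.irreducible (subgroup_poly V + [:a:])"
proof -
  define P where "P = subgroup_poly V + [:a:]"
  have cardV: "card V > 0" by (rule card_fin_subgroup_pos[OF V])
  have degP: "degree P = card V"
    using cardV by (simp add: P_def degree_add_eq_left degree_subgroup_poly)
  then have monicP: "lead_coeff P = 1" and P0: "P \<noteq> 0"
    using lead_coeff_subgroup_poly[of V] cardV by (auto simp: P_def degree_subgroup_poly coeff_eq_0)
  have shiftP: "shift v P = P" if "v \<in> V" for v
    using shift_subgroup_poly_mem[OF char V that] by (simp add: P_def pcompose_add)
  obtain f where f: "Factorial_Ring.irreducible f" "lead_coeff f = 1" "f dvd P"
    using irreducible_factor_exists[of P] degP cardV by auto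
  have f0: "f \<noteq> 0" "degree f > 0" using f(1) by (auto simp: irreducible_def is_unit_iff_degree)
  define W where "W = {v \<in> V. shift v f = f}"
  have W: "fin_subgroup W" using V unfolding fin_subgroup_def W_def
    by (auto simp: pcompose_0' simp flip: shift_shift)
  show ?thesis
  proof (cases "W = V")
    case True
    then have "\<And>u. u \<in> V \<Longrightarrow> shift u f = f" by (auto simp: W_def)
    then obtain h where h: "f = h \<circ>\<^sub>p subgroup_poly V"
      using invariant_imp_pcompose[OF char V] by blast
    then have "degree f = degree h * card V" by (simp add: degree_pcompose degree_subgroup_poly)
    then have "degree P \<le> degree f" using f0(2) degP by (cases "degree h") auto
    moreover obtain k where k: "P = f * k" using f(3) by (elim dvdE)
    moreover have "degree P = degree f + degree k" using k P0 by (simp add: degree_mult_eq)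
    ultimately have "degree k = 0" by simp
    then obtain e where "k = [:e:]" using degree_eq_zeroE by blast
    moreover have "lead_coeff P = lead_coeff f * lead_coeff k" using k by (simp add: lead_coeff_mult)
    ultimately have "e = 1" using f(2) monicP by simp
    then have "P = f" using k \<open>k = [:e:]\<close> by simp
    then show ?thesis using f(1) by (simp add: P_def)
  next
    case False
    then have "W \<subset> V" by (auto simp: W_def)
    then obtain U v where U: "fin_subgroup U" "W \<subseteq> U" and v: "v \<in> V" "v \<notin> U" and VU: "V = U \<union> (+) v ` U"
      using exists_hyperplane[OF char V W] by metis
    define c where "c = poly (subgroup_poly U) v"
    define q where "q = [:a, c, 1:]"
    have Pq: "P = q \<circ>\<^sub>p subgroup_poly U"
      unfolding P_def q_def subgroup_poly_extend[OF char U(1) v(2) VU]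
      by (simp add: pcompose_pCons c_def power2_eq_square algebra_simps)
    have q: "Factorial_Ring.irreducible q"
      using no_root[OF U(1) v VU]
      by (intro irreducible_quadratic) (auto simp: q_def c_def power2_eq_square algebra_simps)
    define N where "N = (\<Prod>u\<in>U. shift u f)"
    have "shift w N = N" if w: "w \<in> U" for w
    proof -
      have "shift w N = (\<Prod>u\<in>U. shift (w + u) f)"
        by (simp add: N_def pcompose_prod shift_shift)
      also have "\<dots> = N" unfolding N_def
        by (rule prod.reindex_bij_betw[OF bij_translate[OF char U(1) w]])
      finally show ?thesis .
    qed
    then obtain h where h: "N = h \<circ>\<^sub>p subgroup_poly U"
      using invariant_imp_pcompose[OF char U(1)] by blast
    have finU: "finite U" and cardU: "card U > 0"
      using U(1) card_fin_subgroup_pos by (auto simp: fin_subgroup_def)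
    have "N dvd (\<Prod>u\<in>U. P)" unfolding N_def
    proof (rule prod_dvd_prod)
      fix u assume "u \<in> U"
      then have "u \<in> V" using VU by blast
      then show "shift u f dvd P" using shift_dvd_shift[OF f(3), of u] shiftP by simp
    qed
    then have "h \<circ>\<^sub>p subgroup_poly U dvd (q ^ card U) \<circ>\<^sub>p subgroup_poly U"
      by (simp add: h Pq pcompose_power_left)
    then have "h dvd q ^ card U"
      by (rule pcompose_dvd_pcompose_imp[rotated]) (use cardU in \<open>simp add: degree_subgroup_poly\<close>)
    moreover have "degree h > 0"
    proof -
      have "degree N = (\<Sum>u\<in>U. degree f)" unfolding N_def using f0
        by (subst degree_prod_eq_sum_degree) (auto simp: degree_pcompose pcompose_eq_0_iff)
      then have "degree N > 0" using cardU f0 by simp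
      then show ?thesis using h by (auto simp: degree_pcompose)
    qed
    ultimately have "q dvd h" using irreducible_dvd_of_dvd_power[OF q] by blast
    then have "P dvd N" unfolding Pq h by (metis dvd_def pcompose_mult)
    moreover have "shift v f dvd P" using shift_dvd_shift[OF f(3), of v] shiftP[OF v(1)] by simp
    ultimately have "shift v f dvd (\<Prod>u\<in>U. shift u f)" using N_def dvd_trans by blast
    moreover have "prime_elem (shift v f)"
      using irreducible_shift[OF char f(1)] by (rule field_poly_irreducible_imp_prime)
    ultimately obtain u where u: "u \<in> U" "shift v f dvd shift u f"
      using prime_elem_dvd_prodE[OF finU] by metis
    have "shift v f = shift u f"
    proof -
      obtain k where k: "shift u f = shift v f * k" using u(2) by (elim dvdE)
      have nz: "shift u f \<noteq> 0" using f0 by (auto simp: pcompose_eq_0_iff)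
      then have "degree (shift u f) = degree (shift v f) + degree k"
        unfolding k by (intro degree_mult_eq) auto
      then have "degree k = 0" by (simp only: degree_shift)
      then obtain e where e: "k = [:e:]" using degree_eq_zeroE[of k] by blast
      have "lead_coeff (shift u f) = lead_coeff (shift v f) * lead_coeff k"
        by (simp only: k lead_coeff_mult)
      then have "e = 1" unfolding lead_coeff_shift f(2) by (simp add: e)
      then show ?thesis using k e by simp
    qed
    then have "shift (v + u) f = f"
      by (metis shift_shift add.commute add_self_CHAR_2[OF char] shift_0)
    moreover have "v + u \<in> V" using V v u VU by (auto simp: fin_subgroup_def)
    ultimately have "v + u \<in> U" using U(2) by (auto simp: W_def)
    then have "(v + u) + u \<in> U" using U(1) u unfolding fin_subgroup_def by blast
    then show ?thesis using v(2) add_self_CHAR_2[OF char, of u] by (simp add: add.assoc)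
  qed
qed

section \<open>Sums over two-adic exponent vectors\<close>

definition zero_or_power2 :: "nat set" where
  "zero_or_power2 = insert 0 (range ((^) 2))"

text \<open>
  Vectors vanish outside \<open>S\<close>, so that each exponent vector on \<open>S\<close> is represented only once.
\<close>

definition exponents :: "'i set \<Rightarrow> nat \<Rightarrow> ('i \<Rightarrow> nat) set" where
  "exponents S m = {\<alpha>. (\<forall>j\<in>S. \<alpha> j \<in> zero_or_power2) \<and> (\<forall>j. j \<notin> S \<longrightarrow> \<alpha> j = 0) \<and> sum \<alpha> S = m}"

text \<open>
  For \<open>m = 2 ^ (card S - 1)\<close> this is the value of \<open>\<Theta>\<close> in the variables indexed by \<open>S\<close>.  Other values
  of \<open>m\<close> arise when one variable is split off.
\<close>

definition two_adic_sum :: "'i set \<Rightarrow> nat \<Rightarrow> ('i \<Rightarrow> 'a::comm_ring_1) \<Rightarrow> 'a" where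
  "two_adic_sum S m x = (\<Sum>\<alpha>\<in>exponents S m. \<Prod>j\<in>S. x j ^ \<alpha> j)"

lemma finite_exponents: "finite S \<Longrightarrow> finite (exponents S m)"
proof (rule finite_subset)
  assume S: "finite S"
  show "exponents S m \<subseteq> {\<alpha>. \<forall>j. (j \<in> S \<longrightarrow> \<alpha> j \<in> {..m}) \<and> (j \<notin> S \<longrightarrow> \<alpha> j = 0)}"
    using S by (auto simp: exponents_def member_le_sum)
  show "finite {\<alpha>::'a \<Rightarrow> nat. \<forall>j. (j \<in> S \<longrightarrow> \<alpha> j \<in> {..m}) \<and> (j \<notin> S \<longrightarrow> \<alpha> j = 0)}"
    by (rule finite_set_of_finite_funs) (use S in auto)
qed

lemma two_adic_sum_cong: "(\<And>j. j \<in> S \<Longrightarrow> x j = x' j) \<Longrightarrow> two_adic_sum S m x = two_adic_sum S m x'"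
  unfolding two_adic_sum_def by (intro sum.cong prod.cong) auto

lemma exponents_0: "finite S \<Longrightarrow> exponents S 0 = {\<lambda>_. 0}"
  by (auto simp: exponents_def zero_or_power2_def)

lemma two_adic_sum_0: "finite S \<Longrightarrow> two_adic_sum S 0 x = 1"
  by (simp add: two_adic_sum_def exponents_0)

lemma two_adic_sum_insert:
  assumes S: "finite S" and y: "y \<notin> S"
  shows "two_adic_sum (insert y S) m x = (\<Sum>e\<in>{e\<in>zero_or_power2. e \<le> m}. x y ^ e * two_adic_sum S (m - e) x)"
proof -
  let ?Q = "{e\<in>zero_or_power2. e \<le> m}"
  have "(\<Sum>e\<in>?Q. x y ^ e * two_adic_sum S (m - e) x) = 
      (\<Sum>(e, \<alpha>)\<in>Sigma ?Q (\<lambda>e. exponents S (m - e)). x y ^ e * (\<Prod>j\<in>S. x j ^ \<alpha> j))"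
    using S by (simp add: two_adic_sum_def sum_distrib_left sum.Sigma finite_exponents)
  also have "\<dots> = two_adic_sum (insert y S) m x" unfolding two_adic_sum_def
  proof (rule sum.reindex_bij_witness[where i = "\<lambda>\<alpha>. (\<alpha> y, \<alpha>(y := 0))" and j = "\<lambda>(e, \<alpha>). \<alpha>(y := e)"])
    fix \<alpha> assume a: "\<alpha> \<in> exponents (insert y S) m"
    have "sum (\<alpha>(y := 0)) S = sum \<alpha> S" by (rule sum.cong) (use y in auto)
    moreover have "\<alpha> y + sum \<alpha> S = m" using a S y by (simp add: exponents_def)
    ultimately show "(\<alpha> y, \<alpha>(y := 0)) \<in> Sigma ?Q (\<lambda>e. exponents S (m - e))"
      using a y by (auto simp: exponents_def)
  next
    fix p assume p: "p \<in> Sigma ?Q (\<lambda>e. exponents S (m - e))"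
    obtain e \<alpha> where e: "p = (e, \<alpha>)" by (cases p)
    have a: "e \<in> zero_or_power2" "e \<le> m" "\<alpha> \<in> exponents S (m - e)" using p e by auto
    have s: "sum (\<alpha>(y := e)) S = sum \<alpha> S" by (rule sum.cong) (use y in auto)
    have "\<alpha>(y := e) \<in> exponents (insert y S) m"
      using a S y s by (auto simp: exponents_def)
    then show "(case p of (e, \<alpha>) \<Rightarrow> \<alpha>(y := e)) \<in> exponents (insert y S) m" by (simp add: e)
    have "\<alpha> y = 0" using a y by (auto simp: exponents_def)
    then show "((case p of (e, \<alpha>) \<Rightarrow> \<alpha>(y := e)) y, (case p of (e, \<alpha>) \<Rightarrow> \<alpha>(y := e))(y := 0)) = p"
      by (auto simp: e fun_eq_iff)
    have "(\<Prod>j\<in>S. x j ^ (\<alpha>(y := e)) j) = (\<Prod>j\<in>S. x j ^ \<alpha> j)"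
      by (rule prod.cong) (use y in auto)
    then show "(\<Prod>j\<in>insert y S. x j ^ (case p of (e, \<alpha>) \<Rightarrow> \<alpha>(y := e)) j) =
        (case p of (e, \<alpha>) \<Rightarrow> x y ^ e * (\<Prod>j\<in>S. x j ^ \<alpha> j))"
      using S y by (simp add: e)
  qed auto
  finally show ?thesis by simp
qed

text \<open>
  Binary carrying: if \<open>2 ^ e\<close> is the smallest summand and \<open>e < n\<close>, it must occur at least twice, and
  merging two copies into \<open>2 ^ (e + 1)\<close> loses one summand while the minimum grows by at most 1.
\<close>

lemma size_powers2_ge:
  assumes "e \<in># M" "\<And>e'. e' \<in># M \<Longrightarrow> e \<le> e'" "2 ^ n dvd (\<Sum>i\<in>#M. 2 ^ i :: nat)"
  shows "Suc n \<le> size M + e"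
  using assms
proof (induction "size M" arbitrary: M e rule: less_induct)
  case less
  obtain M' where M': "M = add_mset e M'" using less.prems(1) by (meson mset_add)
  show ?case
  proof (cases "n \<le> e")
    case True
    then show ?thesis by (simp add: M')
  next
    case False
    have "e \<in># M'"
    proof (rule ccontr)
      assume "e \<notin># M'"
      then have "Suc e \<le> i" if "i \<in># M'" for i
        using less.prems(2)[of i] that M' by (cases "i = e") auto
      then have "2 ^ Suc e dvd (\<Sum>i\<in>#M'. 2 ^ i :: nat)"
        by (induction M') (auto intro!: dvd_add le_imp_power_dvd simp del: power_Suc)
      moreover have "(2::nat) ^ Suc e dvd 2 ^ n" using False by (intro le_imp_power_dvd) auto
      then have "2 ^ Suc e dvd 2 ^ e + (\<Sum>i\<in>#M'. 2 ^ i :: nat)"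
        using less.prems(3) dvd_trans unfolding M' by fastforce
      ultimately have "2 ^ Suc e dvd (2::nat) ^ e" by (meson dvd_add_left_iff)
      then show False by (auto dest: dvd_imp_le)
    qed
    then obtain M'' where M'': "M = add_mset e (add_mset e M'')" using M' by (metis mset_add)
    let ?M = "add_mset (Suc e) M''"
    have sum: "2 ^ n dvd (\<Sum>i\<in>#?M. 2 ^ i :: nat)" using less.prems(3) by (simp add: M'' add_ac mult_2)
    have less': "size ?M < size M" by (simp add: M'')
    show ?thesis
    proof (cases "e \<in># M''")
      case True
      then have "Suc n \<le> size ?M + e" using less.prems(2) by (intro less.hyps[OF less' _ _ sum]) (auto simp: M'')
      then show ?thesis by (simp add: M'')
    next
      case False
      have "Suc n \<le> size ?M + Suc e"
      proof (intro less.hyps[OF less' _ _ sum])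
        fix i assume "i \<in># ?M"
        then show "Suc e \<le> i" using False less.prems(2)[of i] by (cases "i = e") (auto simp: M'')
      qed auto
      then show ?thesis by (simp add: M'')
    qed
  qed
qed

text \<open>
  A sum of powers of two that equals \<open>2 ^ n\<close> and contains 1 needs at least \<open>n + 1\<close> summands, for
  instance \<open>1 + 1 + 2 + 4 + \<dots>\<close>.
\<close>

lemma exponents_no_one:
  assumes S: "finite S" "card S \<le> n" and a: "\<alpha> \<in> exponents S (2 ^ n)" and j: "j \<in> S"
  shows "\<alpha> j \<noteq> 1"
proof
  assume one: "\<alpha> j = 1"
  have "\<forall>i\<in>S. \<exists>e. \<alpha> i \<noteq> 0 \<longrightarrow> \<alpha> i = 2 ^ e" using a by (auto simp: exponents_def zero_or_power2_def)
  then obtain g where g: "\<And>i. i \<in> S \<Longrightarrow> \<alpha> i \<noteq> 0 \<Longrightarrow> \<alpha> i = 2 ^ g i" by metis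
  let ?T = "{i\<in>S. \<alpha> i \<noteq> 0}"
  let ?M = "image_mset g (mset_set ?T)"
  have "g j = 0" using g[OF j] one by (metis nat_power_eq_Suc_0_iff numeral_One One_nat_def numeral_eq_iff one_neq_zero semiring_norm(85))
  then have 1: "0 \<in># ?M" using j one S by (force simp: image_iff)
  have "(\<Sum>i\<in>#?M. 2 ^ i :: nat) = (\<Sum>i\<in>?T. 2 ^ g i)" by (simp add: sum_unfold_sum_mset image_mset.compositionality comp_def)
  also have "\<dots> = (\<Sum>i\<in>?T. \<alpha> i)" by (rule sum.cong) (use g in auto)
  also have "\<dots> = sum \<alpha> S" by (rule sum.mono_neutral_left) (use S in auto)
  also have "\<dots> = 2 ^ n" using a by (simp add: exponents_def)
  finally have "Suc n \<le> size ?M + 0" by (intro size_powers2_ge[OF 1]) auto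
  moreover have "size ?M \<le> card S" using S by (simp add: card_mono)
  ultimately show False using S by simp
qed

lemma zero_or_power2_double: "2 * e \<in> zero_or_power2 \<longleftrightarrow> e \<in> zero_or_power2"
proof
  assume "2 * e \<in> zero_or_power2"
  then consider "e = 0" | i where "2 * e = 2 ^ i" by (auto simp: zero_or_power2_def)
  then show "e \<in> zero_or_power2"
  proof cases
    case 2
    then have "i \<noteq> 0" by (cases i) auto
    then have "e = 2 ^ (i - 1)" using 2 by (cases i) auto
    then show ?thesis by (auto simp: zero_or_power2_def)
  qed (simp add: zero_or_power2_def)
next
  assume "e \<in> zero_or_power2"
  then consider "e = 0" | i where "e = 2 ^ i" by (auto simp: zero_or_power2_def)
  then show "2 * e \<in> zero_or_power2"
    by cases (auto simp: zero_or_power2_def simp flip: power_Suc)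
qed

lemma zero_or_power2_odd: "e \<in> zero_or_power2 \<Longrightarrow> odd e \<Longrightarrow> e = 1"
  by (auto simp: zero_or_power2_def)

text \<open>
  By \<open>exponents_no_one\<close> all exponents of the left-hand side are even; halve them.
\<close>

lemma two_adic_sum_square:
  fixes x :: "'i \<Rightarrow> 'a::comm_ring_1"
  assumes char: "CHAR('a) = 2" and S: "finite S" "card S = Suc n"
  shows "two_adic_sum S (2 ^ Suc n) x = two_adic_sum S (2 ^ n) x ^ 2"
proof -
  have "two_adic_sum S (2 ^ n) x ^ 2 = (\<Sum>\<alpha>\<in>exponents S (2 ^ n). \<Prod>j\<in>S. x j ^ (2 * \<alpha> j))"
    unfolding two_adic_sum_def by (subst freshmans_dream_sum) (auto simp: char prod_power_distrib mult.commute simp flip: power_mult)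
  also have "\<dots> = two_adic_sum S (2 ^ Suc n) x" unfolding two_adic_sum_def
  proof (rule sum.reindex_bij_witness[where i = "\<lambda>\<alpha> j. \<alpha> j div 2" and j = "\<lambda>\<alpha> j. 2 * \<alpha> j"])
    fix \<alpha> assume "\<alpha> \<in> exponents S (2 ^ n)"
    then show "(\<lambda>j. 2 * \<alpha> j) \<in> exponents S (2 ^ Suc n)"
      by (auto simp: exponents_def zero_or_power2_double simp flip: sum_distrib_left)
  next
    fix \<alpha> assume a: "\<alpha> \<in> exponents S (2 ^ Suc n)"
    have ev: "even (\<alpha> j)" for j
    proof (cases "j \<in> S")
      case True
      then have "\<alpha> j \<noteq> 1" using exponents_no_one[OF S(1) _ a True] S by simp
      then show ?thesis using a True zero_or_power2_odd by (auto simp: exponents_def)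
    qed (use a in \<open>auto simp: exponents_def\<close>)
    then show "(\<lambda>j. 2 * (\<alpha> j div 2)) = \<alpha>" by simp
    have "2 * (\<Sum>j\<in>S. \<alpha> j div 2) = sum \<alpha> S" using ev by (simp add: sum_distrib_left)
    then show "(\<lambda>j. \<alpha> j div 2) \<in> exponents S (2 ^ n)"
      using a ev zero_or_power2_double[of "\<alpha> _ div 2"] by (auto simp: exponents_def)
  qed auto
  finally show ?thesis by simp
qed

lemma sum_symmetric_CHAR_2:
  fixes f :: "nat \<Rightarrow> nat \<Rightarrow> 'a::comm_ring_1"
  assumes char: "CHAR('a) = 2" and T: "finite T" "\<And>a b. (a, b) \<in> T \<Longrightarrow> (b, a) \<in> T"
    and f: "\<And>a b. f a b = f b a"
  shows "(\<Sum>(a, b)\<in>T. f a b) = (\<Sum>a\<in>{a. (a, a) \<in> T}. f a a)"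
proof -
  let ?L = "{(a, b)\<in>T. a < b}" and ?G = "{(a, b)\<in>T. b < a}" and ?E = "{(a, b)\<in>T. a = b}"
  have *: "finite ?L" "finite ?G" "finite ?E" using T(1) by (auto intro: rev_finite_subset)
  have "T = ?E \<union> (?L \<union> ?G)" by auto
  then have "(\<Sum>(a, b)\<in>T. f a b) = (\<Sum>(a, b)\<in>?E \<union> (?L \<union> ?G). f a b)" by simp
  also have "\<dots> = (\<Sum>(a, b)\<in>?E. f a b) + ((\<Sum>(a, b)\<in>?L. f a b) + (\<Sum>(a, b)\<in>?G. f a b))"
    using * by (subst sum.union_disjoint sum.union_disjoint | auto)+
  also have "(\<Sum>(a, b)\<in>?L. f a b) = (\<Sum>(a, b)\<in>?G. f a b)"
    by (rule sum.reindex_bij_witness[where i = prod.swap and j = prod.swap]) (use T f in auto)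
  also have "(\<Sum>(a, b)\<in>?G. f a b) + (\<Sum>(a, b)\<in>?G. f a b) = 0" by (rule add_self_CHAR_2[OF char])
  also have "(\<Sum>(a, b)\<in>?E. f a b) = (\<Sum>a\<in>{a. (a, a) \<in> T}. f a a)"
    by (rule sum.reindex_bij_witness[where i = "\<lambda>a. (a, a)" and j = fst]) auto
  finally show ?thesis by simp
qed

text \<open>
  Exchanging the exponents of the two equal variables is an involution on the terms, which therefore
  cancel except where both exponents equal some \<open>e\<close>.  These combine to a single exponent \<open>2 e\<close>, so
  all terms of the right-hand side appear except those in which \<open>x j\<close> has exponent 1.  There are no
  such terms by \<open>exponents_no_one\<close>.
\<close>

lemma two_adic_sum_repeated:
  fixes x :: "'i \<Rightarrow> 'a::comm_ring_1"
  assumes char: "CHAR('a) = 2" and S: "finite S" "card S = n" and y: "y \<notin> S" and j: "j \<in> S"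
    and xy: "x y = x j"
  shows "two_adic_sum (insert y S) (2 ^ n) x = two_adic_sum S (2 ^ n) x"
proof -
  define m :: nat where "m = 2 ^ n"
  obtain S' where S': "S = insert j S'" "j \<notin> S'" using j by (meson mk_disjoint_insert)
  have fin: "finite S'" using S S' by simp
  define G where "G = (\<lambda>m. two_adic_sum S' m x)"
  define Q where "Q = (\<lambda>m. {e\<in>zero_or_power2. e \<le> m})"
  have finQ: "finite (Q m)" for m by (simp add: Q_def)
  have PS: "two_adic_sum S m x = (\<Sum>e\<in>Q m. x j ^ e * G (m - e))" for m
    unfolding S'(1) G_def Q_def by (rule two_adic_sum_insert[OF fin S'(2)])
  let ?T = "Sigma (Q m) (\<lambda>e. Q (m - e))"
  have T: "?T = {(e, e'). e \<in> zero_or_power2 \<and> e' \<in> zero_or_power2 \<and> e + e' \<le> m}"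
    by (auto simp: Q_def)
  have "two_adic_sum (insert y S) m x = (\<Sum>e\<in>Q m. x j ^ e * two_adic_sum S (m - e) x)"
    unfolding Q_def by (subst two_adic_sum_insert[OF S(1) y]) (simp add: xy)
  also have "\<dots> = (\<Sum>(e, e')\<in>?T. x j ^ (e + e') * G (m - (e + e')))"
    by (simp add: PS sum_distrib_left sum.Sigma finQ power_add mult.assoc)
  \<comment> \<open>The terms with different exponents of the two equal variables cancel.\<close>
  also have "\<dots> = (\<Sum>e\<in>{e. (e, e) \<in> ?T}. x j ^ (e + e) * G (m - (e + e)))"
    by (rule sum_symmetric_CHAR_2[OF char]) (use finQ in \<open>auto simp: Q_def add.commute\<close>)
  also have "\<dots> = (\<Sum>e\<in>Q m - {1}. x j ^ e * G (m - e))"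
  proof (rule sum.reindex_bij_witness[where i = "\<lambda>e. e div 2" and j = "\<lambda>e. e + e"])
    fix e assume e: "e \<in> Q m - {1}"
    then have ev: "even e" using zero_or_power2_odd by (auto simp: Q_def)
    then show ee: "e div 2 + e div 2 = e" by (metis mult_2 dvd_mult_div_cancel)
    have "e div 2 \<in> zero_or_power2" using e ev zero_or_power2_double[of "e div 2"] by (auto simp: Q_def)
    then show "e div 2 \<in> {e. (e, e) \<in> ?T}" using e ee unfolding T by (simp add: Q_def)
  next
    fix e assume "e \<in> {e. (e, e) \<in> ?T}"
    then show "e + e \<in> Q m - {1}" using zero_or_power2_double[of e]
      by (auto simp: T Q_def simp flip: mult_2)
  qed auto
  \<comment> \<open>The exponent 1 contributes nothing.\<close>
  also have "\<dots> = (\<Sum>e\<in>Q m. x j ^ e * G (m - e))"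
  proof (rule sum.mono_neutral_left[OF finQ], blast, rule ballI)
    fix e assume "e \<in> Q m - (Q m - {1})"
    then have e: "e = 1" by auto
    have "exponents S' (m - 1) = {}"
    proof (rule ccontr)
      assume "\<not> ?thesis"
      then obtain \<alpha> where a: "\<alpha> \<in> exponents S' (m - 1)" by blast
      have s: "sum (\<alpha>(j := 1)) S' = sum \<alpha> S'" by (rule sum.cong) (use S' in auto)
      have "1 \<in> zero_or_power2" unfolding zero_or_power2_def by (metis insertI2 power_0 rangeI)
      then have "\<alpha>(j := 1) \<in> exponents S (2 ^ n)"
        using a fin S' s by (auto simp: exponents_def m_def)
      from exponents_no_one[OF S(1) _ this j] show False using S by simp
    qed
    then show "x j ^ e * G (m - e) = 0" using e by (simp add: G_def two_adic_sum_def)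
  qed
  also have "\<dots> = two_adic_sum S m x" by (simp add: PS)
  finally show ?thesis by (simp add: m_def)
qed

definition subset_sums :: "'i set \<Rightarrow> ('i \<Rightarrow> 'a::comm_ring_1) \<Rightarrow> 'a set" where
  "subset_sums S x = sum x ` Pow S"

lemma two_adic_sum_map:
  fixes S :: "'i set" and h :: "'a::comm_ring_1 \<Rightarrow> 'b::comm_ring_1"
  assumes "\<And>a b. h (a + b) = h a + h b" "\<And>a b. h (a * b) = h a * h b" "h 0 = 0" "h 1 = 1"
  shows "h (two_adic_sum S m x) = two_adic_sum S m (\<lambda>j. h (x j))"
proof -
  have hs: "h (sum f A) = (\<Sum>a\<in>A. h (f a))" for f and A :: "('i \<Rightarrow> nat) set"
    by (induction A rule: infinite_finite_induct) (auto simp: assms)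
  have hp: "h (prod f A) = (\<Prod>a\<in>A. h (f a))" for f and A :: "'i set"
    by (induction A rule: infinite_finite_induct) (auto simp: assms)
  have hw: "h (a ^ n) = h a ^ n" for a n by (induction n) (auto simp: assms)
  show ?thesis by (simp add: two_adic_sum_def hs hp hw)
qed

lemma fin_subgroup_subset_sums:
  fixes x :: "'i \<Rightarrow> 'a::comm_ring_1"
  assumes char: "CHAR('a) = 2" and S: "finite S"
  shows "fin_subgroup (subset_sums S x)"
  unfolding fin_subgroup_def
proof (intro conjI ballI)
  show "finite (subset_sums S x)" using S by (simp add: subset_sums_def)
  show "0 \<in> subset_sums S x" unfolding subset_sums_def by (rule image_eqI[of _ _ "{}"]) auto
  fix u v assume "u \<in> subset_sums S x" "v \<in> subset_sums S x"
  then obtain A B where AB: "A \<subseteq> S" "B \<subseteq> S" "u = sum x A" "v = sum x B" by (auto simp: subset_sums_def)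
  have fin: "finite A" "finite B" using AB S finite_subset by auto
  have "sum x A = sum x (A - B) + sum x (A \<inter> B)" "sum x B = sum x (B - A) + sum x (A \<inter> B)"
    using fin by (metis sum.Int_Diff add.commute, metis sum.Int_Diff add.commute Int_commute)
  then have "u + v = sum x (A - B) + sum x (B - A) + (sum x (A \<inter> B) + sum x (A \<inter> B))"
    using AB by (simp add: add_ac)
  also have "\<dots> = sum x ((A - B) \<union> (B - A))"
    using fin by (subst sum.union_disjoint) (auto simp: add_self_CHAR_2[OF char])
  finally show "u + v \<in> subset_sums S x" using AB by (auto simp: subset_sums_def)
qed

lemma subset_sums_mem: "j \<in> S \<Longrightarrow> x j \<in> subset_sums S x"
  unfolding subset_sums_def by (rule image_eqI[of _ _ "{j}"]) auto

lemma power_add_zero_or_power2: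
  fixes a b :: "'a::comm_ring_1"
  assumes char: "CHAR('a) = 2" and e: "e \<in> zero_or_power2" "e \<noteq> 0"
  shows "(a + b) ^ e = a ^ e + b ^ e"
proof -
  obtain i where "e = 2 ^ i" using e by (auto simp: zero_or_power2_def)
  then show ?thesis using char by (intro freshmans_dream') auto
qed

text \<open>
  The identity \<open>\<Theta> = D\<^sub>V(Y) + c\<^sub>V\<^sup>2\<close>.  Let \<open>A\<close> consist of the terms with positive exponent of \<open>Y\<close>.  It is
  additive, since only the powers \<open>Y ^ 2 ^ i\<close> occur, and it vanishes on the generators of \<open>V\<close> by
  \<open>two_adic_sum_repeated\<close>, hence on \<open>V\<close>.  Being monic of degree \<open>2 ^ n = card V\<close> it equals \<open>D\<^sub>V\<close>.
  Its coefficients are visible, which gives \<open>c\<^sub>V = \<Theta>\<^sub>n\<close>, and the terms free of \<open>Y\<close> give \<open>\<Theta>\<^sub>n\<^sup>2\<close> by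
  \<open>two_adic_sum_square\<close>.
\<close>

lemma
  fixes x :: "'i \<Rightarrow> 'a::idom"
  assumes char: "CHAR('a) = 2" and S: "finite S" "card S = n" "n > 0" and y: "y \<notin> S"
    and inj: "inj_on (sum x) (Pow S)"
  shows mid_coeff_subset_sums: "mid_coeff (subset_sums S x) = two_adic_sum S (2 ^ (n - 1)) x"
    and two_adic_sum_eq_subgroup_poly:
      "two_adic_sum (insert y S) (2 ^ n) (\<lambda>j. if j = y then [:0, 1:] else [:x j:]) =
         subgroup_poly (subset_sums S x) + [:mid_coeff (subset_sums S x) ^ 2:]"
proof -
  let ?V = "subset_sums S x"
  have cardV: "card ?V = 2 ^ n" using inj S by (simp add: subset_sums_def card_image card_Pow)
  define Q where "Q = {e\<in>zero_or_power2. e \<le> 2 ^ n \<and> e \<noteq> 0}"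
  define A where "A = (\<Sum>e\<in>Q. monom (two_adic_sum S (2 ^ n - e) x) e)"
  have finQ: "finite Q" by (rule finite_subset[of _ "{..2 ^ n}"]) (auto simp: Q_def)
  have Q_split: "{e\<in>zero_or_power2. e \<le> 2 ^ n} = insert 0 Q" "0 \<notin> Q"
    by (auto simp: Q_def zero_or_power2_def)
  have pow2: "2 ^ i \<in> zero_or_power2" for i by (auto simp: zero_or_power2_def)
  have coeffA: "coeff A i = (if i \<in> Q then two_adic_sum S (2 ^ n - i) x else 0)" for i
    using finQ by (simp add: A_def coeff_sum sum.delta')
  have polyA: "poly A z = (\<Sum>e\<in>Q. z ^ e * two_adic_sum S (2 ^ n - e) x)" for z
    by (simp add: A_def poly_sum poly_monom mult.commute)
  have addA: "poly A (u + v) = poly A u + poly A v" for u v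
    by (simp add: polyA Q_def power_add_zero_or_power2[OF char] distrib_right sum.distrib)
  have A0: "poly A 0 = 0" by (simp add: polyA Q_def power_0_left)
  have Aj: "poly A (x j) = 0" if j: "j \<in> S" for j
  proof -
    let ?x = "x(y := x j)"
    have *: "two_adic_sum S m ?x = two_adic_sum S m x" for m by (rule two_adic_sum_cong) (use y in auto)
    have "two_adic_sum S (2 ^ n) x + poly A (x j) = two_adic_sum (insert y S) (2 ^ n) ?x"
      unfolding two_adic_sum_insert[OF S(1) y] Q_split(1) using finQ Q_split(2) * by (simp add: polyA)
    also have "\<dots> = two_adic_sum S (2 ^ n) ?x" by (rule two_adic_sum_repeated[OF char S(1,2) y j]) (use j y in auto)
    finally show ?thesis using * by simp
  qed
  have AV: "poly A v = 0" if "v \<in> ?V" for v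
  proof -
    have "poly A (sum x T) = 0" if "T \<subseteq> S" for T
      using finite_subset[OF that S(1)] that by (induction T rule: finite_induct) (auto simp: A0 addA Aj)
    then show ?thesis using that by (auto simp: subset_sums_def)
  qed
  have V: "fin_subgroup ?V" by (rule fin_subgroup_subset_sums[OF char S(1)])
  have A: "subgroup_poly ?V = A"
  proof (rule poly_eqI_degree_lead_coeff[where n = "2 ^ n" and A = ?V])
    show "coeff (subgroup_poly ?V) (2 ^ n) = coeff A (2 ^ n)"
      using lead_coeff_subgroup_poly[of ?V] pow2 S(1)
      by (auto simp: degree_subgroup_poly cardV coeffA Q_def two_adic_sum_0)
    show "degree A \<le> 2 ^ n" by (rule degree_le) (auto simp: coeffA Q_def)
    show "degree (subgroup_poly ?V) \<le> 2 ^ n" by (simp add: degree_subgroup_poly cardV)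
    show "poly (subgroup_poly ?V) v = poly A v" if "v \<in> ?V" for v
      using AV[OF that] poly_subgroup_poly_root[OF char V that] by simp
  qed (simp add: cardV)
  obtain n' where n': "n = Suc n'" using S(3) by (cases n) auto
  have "mid_coeff ?V = coeff A (2 ^ n')" by (simp add: mid_coeff_def A cardV n')
  also have "\<dots> = two_adic_sum S (2 ^ n') x" using pow2[of n'] by (auto simp: coeffA Q_def n')
  finally show mid: "mid_coeff ?V = two_adic_sum S (2 ^ (n - 1)) x" by (simp add: n')
  let ?x = "\<lambda>j. if j = y then [:0, 1:] else [:x j:]"
  have "two_adic_sum S m ?x = two_adic_sum S m (\<lambda>j. [:x j:])" for m by (rule two_adic_sum_cong) (use y in auto)
  also have "two_adic_sum S m (\<lambda>j. [:x j:]) = [:two_adic_sum S m x:]" for m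
    by (subst two_adic_sum_map[of "\<lambda>a. [:a:]"]) (auto simp: one_pCons)
  finally have const: "two_adic_sum S m ?x = [:two_adic_sum S m x:]" for m .
  have "two_adic_sum (insert y S) (2 ^ n) ?x = [:two_adic_sum S (2 ^ n) x:] + A"
    unfolding two_adic_sum_insert[OF S(1) y] Q_split(1) using finQ Q_split(2)
    by (simp add: const A_def monom_altdef mult.commute)
  also have "two_adic_sum S (2 ^ n) x = mid_coeff ?V ^ 2"
    using two_adic_sum_square[OF char S(1), of n' x] S(2) by (simp add: mid n')
  finally show "two_adic_sum (insert y S) (2 ^ n) ?x = subgroup_poly ?V + [:mid_coeff ?V ^ 2:]"
    by (simp add: A add.commute)
qed

section \<open>Degree and order estimates\<close>

lemma CHAR_fract: "CHAR('a::idom fract) = CHAR('a)"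
proof (rule CHAR_eqI)
  have *: "of_nat n = to_fract (of_nat n :: 'a)" for n by (induction n) auto
  show "of_nat CHAR('a) = (0 :: 'a fract)" by (simp only: * of_nat_CHAR to_fract_0)
  show "CHAR('a) dvd n" if "of_nat n = (0 :: 'a fract)" for n
    using that unfolding * to_fract_eq_0_iff by (simp add: of_nat_eq_0_iff_char_dvd)
qed

lemma inj_on_sum_Pow:
  fixes x :: "'i \<Rightarrow> 'a::comm_ring_1"
  assumes char: "CHAR('a) = 2" and S: "finite S"
    and nz: "\<And>T. T \<subseteq> S \<Longrightarrow> T \<noteq> {} \<Longrightarrow> sum x T \<noteq> 0"
  shows "inj_on (sum x) (Pow S)"
proof (rule inj_onI)
  fix A B assume AB: "A \<in> Pow S" "B \<in> Pow S" "sum x A = sum x B"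
  have fin: "finite A" "finite B" using AB S finite_subset by auto
  have "sum x A = sum x (A - B) + sum x (A \<inter> B)" "sum x B = sum x (B - A) + sum x (A \<inter> B)"
    using fin by (metis sum.Int_Diff add.commute, metis sum.Int_Diff add.commute Int_commute)
  then have "sum x (A - B) = sum x (B - A)" using AB(3) by simp
  then have "sum x ((A - B) \<union> (B - A)) = 0"
    using fin by (subst sum.union_disjoint) (auto simp: add_self_CHAR_2[OF char])
  then have "(A - B) \<union> (B - A) = {}" using nz[of "(A - B) \<union> (B - A)"] AB by blast
  then show "A = B" by blast
qed

lemma coeff_subgroup_poly_image:
  assumes h: "\<And>a b. h (a + b) = h a + h b" "\<And>a b. h (a * b) = h a * h b" "h 0 = 0" "h 1 = 1"
    and U: "finite U" "inj_on h U"
  shows "coeff (subgroup_poly (h ` U)) i = h (coeff (subgroup_poly U) i)"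
proof -
  have "coeff (\<Prod>u\<in>T. [:h u, 1:]) i = h (coeff (\<Prod>u\<in>T. [:u, 1:]) i)" if "finite T" for T i
    using that
  proof (induction T arbitrary: i rule: finite_induct)
    case empty
    then show ?case by (simp add: h coeff_pCons one_pCons split: nat.split)
  next
    case (insert u T)
    then show ?case by (simp add: h coeff_pCons split: nat.split)
  qed
  then show ?thesis using U by (simp add: subgroup_poly_def prod.reindex)
qed

lemma poly_subgroup_poly_image:
  assumes h: "\<And>a b. h (a + b) = h a + h b" "\<And>a b. h (a * b) = h a * h b" "h 0 = 0" "h 1 = 1"
    and U: "inj_on h U"
  shows "poly (subgroup_poly (h ` U)) (h v) = h (poly (subgroup_poly U) v)"
proof -
  have hp: "h (prod f A) = (\<Prod>a\<in>A. h (f a))" for f and A :: "'a set"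
    by (induction A rule: infinite_finite_induct) (auto simp: h)
  show ?thesis using U by (simp add: poly_subgroup_poly prod.reindex hp h)
qed

lemma mid_coeff_image:
  assumes "\<And>a b. h (a + b) = h a + h b" "\<And>a b. h (a * b) = h a * h b" "h 0 = 0" "h 1 = 1"
    and "finite U" "inj_on h U"
  shows "mid_coeff (h ` U) = h (mid_coeff U)"
  using coeff_subgroup_poly_image[of h, OF assms] assms(5,6) by (simp add: mid_coeff_def card_image)

lemma subset_sums_image:
  fixes S :: "'b set"
  assumes "\<And>a b. h (a + b) = h a + h b" "h 0 = 0"
  shows "h ` subset_sums S x = subset_sums S (\<lambda>j. h (x j))"
proof -
  have "h (sum f A) = (\<Sum>a\<in>A. h (f a))" for f :: "'b \<Rightarrow> _" and A
    by (induction A rule: infinite_finite_induct) (auto simp: assms)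
  then show ?thesis by (simp add: subset_sums_def image_image)
qed

lemma exists_max_degree:
  fixes y :: "'i \<Rightarrow> 'a::comm_ring_1 poly"
  assumes T: "finite T" "T \<noteq> {}" and y: "inj_on (\<lambda>j. degree (y j)) T"
  obtains j where "j \<in> T" "\<And>i. i \<in> T - {j} \<Longrightarrow> degree (y i) < degree (y j)"
proof -
  obtain j where j: "j \<in> T" "degree (y j) = Max ((\<lambda>j. degree (y j)) ` T)"
    using T obtains_MAX by metis
  have "degree (y i) < degree (y j)" if "i \<in> T - {j}" for i
  proof -
    have "degree (y i) \<le> degree (y j)" using j T that by auto
    moreover have "degree (y i) \<noteq> degree (y j)" using inj_onD[OF y _ _ j(1), of i] that by blast
    ultimately show ?thesis by simp
  qed
  then show ?thesis using that j by blast
qed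

lemma sum_distinct_degrees_nonzero:
  fixes y :: "'i \<Rightarrow> 'a::comm_ring_1 poly"
  assumes T: "finite T" "T \<noteq> {}" and y: "inj_on (\<lambda>j. degree (y j)) T" "\<And>j. j \<in> T \<Longrightarrow> degree (y j) > 0"
  shows "sum y T \<noteq> 0"
proof -
  obtain j where j: "j \<in> T" "\<And>i. i \<in> T - {j} \<Longrightarrow> degree (y i) < degree (y j)"
    using exists_max_degree[OF T y(1)] by blast
  have "degree (sum y (T - {j})) < degree (y j)"
    by (rule degree_sum_less) (use j y in auto)
  then have "degree (y j + sum y (T - {j})) = degree (y j)" by (rule degree_add_eq_left)
  then have "degree (sum y T) = degree (y j)" using T j by (simp add: sum.remove)
  then show ?thesis using y(2)[OF j(1)] by auto
qed

lemma degree_two_adic_sum_le: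
  fixes y :: "'i \<Rightarrow> 'a::comm_ring_1 poly"
  assumes "\<And>j. j \<in> S \<Longrightarrow> degree (y j) \<le> b"
  shows "degree (two_adic_sum S m y) \<le> m * b"
proof (cases "finite S")
  case S: True
  show ?thesis unfolding two_adic_sum_def
  proof (rule degree_sum_le[OF finite_exponents[OF S]])
    fix \<alpha> assume a: "\<alpha> \<in> exponents S m"
    have "degree (\<Prod>j\<in>S. y j ^ \<alpha> j) \<le> (\<Sum>j\<in>S. degree (y j ^ \<alpha> j))"
      using degree_prod_sum_le[OF S, of "\<lambda>j. y j ^ \<alpha> j"] by (simp add: comp_def)
    also have "\<dots> \<le> (\<Sum>j\<in>S. b * \<alpha> j)"
      by (intro sum_mono order.trans[OF degree_power_le] mult_right_mono assms) auto
    also have "\<dots> = m * b" using a by (simp add: exponents_def mult.commute flip: sum_distrib_left)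
    finally show "degree (\<Prod>j\<in>S. y j ^ \<alpha> j) \<le> m * b" .
  qed
next
  case False
  then have "(\<Prod>j\<in>S. y j ^ \<alpha> j) = 1" for \<alpha> by simp
  then show ?thesis by (simp add: two_adic_sum_def)
qed

text \<open>
  If the variable \<open>j\<close> has the largest degree \<open>d\<close>, the term \<open>y j ^ 2 ^ n\<close> dominates: in any other
  term a part of the total exponent goes to variables of degree at most \<open>d - 1\<close>.
\<close>

lemma two_adic_sum_distinct_degrees_nonzero:
  fixes y :: "'i \<Rightarrow> 'a::idom poly"
  assumes S: "finite S" "S \<noteq> {}" and y: "inj_on (\<lambda>j. degree (y j)) S" "\<And>j. j \<in> S \<Longrightarrow> degree (y j) > 0"
  shows "two_adic_sum S (2 ^ n) y \<noteq> 0"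
proof -
  obtain j where j: "j \<in> S" "\<And>i. i \<in> S - {j} \<Longrightarrow> degree (y i) < degree (y j)"
    using exists_max_degree[OF S y(1)] by blast
  define d where "d = degree (y j)"
  have d: "d > 0" using y(2)[OF j(1)] by (simp add: d_def)
  define M :: nat where "M = 2 ^ n"
  have M: "M > 0" by (simp add: M_def)
  define Q where "Q = {e\<in>zero_or_power2. e \<le> M}"
  have finQ: "finite Q" by (simp add: Q_def)
  have MQ: "M \<in> Q" by (auto simp: Q_def M_def zero_or_power2_def)
  let ?S = "S - {j}"
  have "two_adic_sum S M y = (\<Sum>e\<in>Q. y j ^ e * two_adic_sum ?S (M - e) y)"
    using two_adic_sum_insert[of ?S j M y] S j(1) by (simp add: insert_absorb Q_def)
  also have "\<dots> = y j ^ M + (\<Sum>e\<in>Q - {M}. y j ^ e * two_adic_sum ?S (M - e) y)"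
    using S by (subst sum.remove[OF finQ MQ]) (simp add: two_adic_sum_0)
  finally have eq: "two_adic_sum S M y = y j ^ M + (\<Sum>e\<in>Q - {M}. y j ^ e * two_adic_sum ?S (M - e) y)" .
  have "degree (\<Sum>e\<in>Q - {M}. y j ^ e * two_adic_sum ?S (M - e) y) < d * M"
  proof (rule degree_sum_less)
    fix e assume "e \<in> Q - {M}"
    then have e: "e < M" by (auto simp: Q_def)
    have "degree (y i) \<le> d - 1" if "i \<in> ?S" for i using j(2)[OF that] by (simp add: d_def)
    then have "degree (two_adic_sum ?S (M - e) y) \<le> (M - e) * (d - 1)" by (rule degree_two_adic_sum_le)
    then have "degree (y j ^ e * two_adic_sum ?S (M - e) y) \<le> d * e + (M - e) * (d - 1)"
      using degree_mult_le[of "y j ^ e" "two_adic_sum ?S (M - e) y"] degree_power_le[of "y j" e]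
      by (simp add: d_def)
    also have "\<dots> < d * e + (M - e) * d" using e d by simp
    also have "\<dots> = d * M" using e by (simp add: algebra_simps flip: add_mult_distrib2)
    finally show "degree (y j ^ e * two_adic_sum ?S (M - e) y) < d * M" .
  qed (use d M in simp)
  moreover have yj: "degree (y j ^ M) = d * M" using y(2)[OF j(1)] by (subst degree_power_eq) (auto simp: d_def)
  ultimately have "degree (two_adic_sum S M y) = d * M" unfolding eq by (subst degree_add_eq_left) auto
  then have "degree (two_adic_sum S M y) \<noteq> 0" using d M by simp
  then show ?thesis unfolding M_def by (metis degree_0)
qed

text \<open>
  Let \<open>e\<close> and \<open>k\<close> be the orders of \<open>p\<close> and \<open>r\<close> at \<open>a\<close>.  The three summands have orders \<open>2 e\<close>, at least
  \<open>1 + e + k\<close>, and \<open>1 + 2 k\<close>.  For \<open>e \<le> k\<close> the first is strictly the smallest and otherwise the last,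
  so nothing can cancel the leading term.
\<close>

lemma no_root_odd_order:
  fixes c d p r :: "'a::idom poly"
  assumes c: "c = [:- a, 1:] * c'" "poly c' a \<noteq> 0" and d: "poly d a \<noteq> 0" and r: "r \<noteq> 0"
  shows "p ^ 2 + c * p * r + c * d * r ^ 2 \<noteq> 0"
proof
  assume eq: "p ^ 2 + c * p * r + c * d * r ^ 2 = 0"
  have "c' \<noteq> 0" "d \<noteq> 0" using c d by auto
  moreover have "c \<noteq> 0" unfolding c(1) using \<open>c' \<noteq> 0\<close> by (intro no_zero_divisors) auto
  ultimately have "c * d * r ^ 2 \<noteq> 0" using r by simp
  then have p: "p \<noteq> 0" using eq by auto
  define t where "t = [:- a, 1:]"
  have t: "t \<noteq> 0" "poly t a = 0" by (auto simp: t_def)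
  have ev: "poly q a \<noteq> 0" if "\<not> t dvd q" for q using that by (simp add: poly_eq_0_iff_dvd t_def)
  obtain e p' where p': "p = t ^ e * p'" "poly p' a \<noteq> 0" using order_decomp[OF p, of a] ev unfolding t_def by metis
  obtain k r' where r': "r = t ^ k * r'" "poly r' a \<noteq> 0" using order_decomp[OF r, of a] ev unfolding t_def by metis
  have c: "c = t * c'" using c by (simp add: t_def)
  show False
  proof (cases "e \<le> k")
    case True
    then obtain m where m: "k = e + m" using le_Suc_ex by blast
    have "t ^ (2 * e) * (p' ^ 2 + t * (c' * p' * t ^ m * r' + c' * d * t ^ (2 * m) * r' ^ 2)) = 0"
      using eq unfolding p' r' c m by (simp add: power_add power_mult power2_eq_square algebra_simps)
    then have "p' ^ 2 + t * (c' * p' * t ^ m * r' + c' * d * t ^ (2 * m) * r' ^ 2) = 0" using t by simp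
    then have "poly (p' ^ 2 + t * (c' * p' * t ^ m * r' + c' * d * t ^ (2 * m) * r' ^ 2)) a = 0" by simp
    then show False using p'(2) by (simp add: t(2))
  next
    case False
    then obtain m where m: "e = Suc k + m" using le_Suc_ex[of "Suc k" e] by auto
    have "(t ^ (2 * k) * t) * (c' * d * r' ^ 2 + t * (t ^ (2 * m) * p' ^ 2 + t ^ m * c' * p' * r')) = 0"
      using eq unfolding p' r' c m by (simp add: power_add power_mult power2_eq_square algebra_simps)
    then have "c' * d * r' ^ 2 + t * (t ^ (2 * m) * p' ^ 2 + t ^ m * c' * p' * r') = 0" using t by simp
    then have "poly (c' * d * r' ^ 2 + t * (t ^ (2 * m) * p' ^ 2 + t ^ m * c' * p' * r')) a = 0" by simp
    then show False using r'(2) c d assms(2) by (simp add: t(2))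
  qed
qed

section \<open>An irreducible specialisation\<close>

text \<open>
  The specialisation \<open>x\<^sub>j = s\<^sup>h\<^sup>(\<^sup>j\<^sup>) (t + s\<^sup>h\<^sup>(\<^sup>j\<^sup>))\<close>, with inner variable \<open>s\<close> and outer variable \<open>t\<close>.  In
  characteristic 2 the element \<open>x\<^sub>i\<close> has its only root at \<open>t = s\<^sup>h\<^sup>(\<^sup>i\<^sup>)\<close>, a simple one.  There \<open>x\<^sub>j\<close>
  takes a value of \<open>s\<close>-degree \<open>h j + max (h j) (h i)\<close>; the leading factor \<open>s\<^sup>h\<^sup>(\<^sup>j\<^sup>)\<close> makes these
  degrees distinct for distinct \<open>j\<close>, also for those with \<open>h j < h i\<close>.
\<close>

definition test_point :: "('i \<Rightarrow> nat) \<Rightarrow> 'i \<Rightarrow> 'a::comm_ring_1 poly poly" where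
  "test_point h j = smult (monom 1 (h j)) [:monom 1 (h j), 1:]"

lemma poly_test_point:
  "poly (test_point h j) (monom 1 k) = monom 1 (h j) * (monom 1 (h j) + monom (1::'a::comm_ring_1) k)"
  by (simp add: test_point_def distrib_left mult.commute)

lemma degree_monom_add_monom:
  assumes "m \<noteq> k"
  shows "degree (monom (1::'a::idom) m + monom 1 k) = max m k"
proof (cases "m < k")
  case True
  then show ?thesis by (subst degree_add_eq_right) (auto simp: degree_monom_eq)
next
  case False
  then show ?thesis using assms by (subst degree_add_eq_left) (auto simp: degree_monom_eq)
qed

lemma degree_poly_test_point:
  assumes "h j \<noteq> k"
  shows "degree (poly (test_point h j) (monom 1 k) :: 'a::idom poly) = h j + max (h j) k"
proof -
  have d: "degree (monom (1::'a) (h j) + monom 1 k) = max (h j) k" by (rule degree_monom_add_monom[OF assms])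
  then have "monom (1::'a) (h j) + monom 1 k \<noteq> 0" using assms by auto
  then show ?thesis unfolding poly_test_point using d by (subst degree_mult_eq) (auto simp: degree_monom_eq)
qed

context
  fixes S :: "'i set" and h :: "'i \<Rightarrow> nat" and x :: "'i \<Rightarrow> 'a::idom poly poly"
  assumes char: "CHAR('a) = 2" and S: "finite S" and h: "inj_on h S"
  defines "x \<equiv> test_point h"
begin

lemma char_poly: "CHAR('a poly) = 2" "CHAR('a poly poly) = 2" "CHAR('a poly poly fract) = 2"
  using char by (simp_all add: CHAR_fract)

lemma test_point_root: "poly (x i) (monom 1 (h i)) = 0"
  unfolding x_def poly_test_point by (simp add: add_self_CHAR_2[OF char_poly(1)])

lemma test_point_values:
  assumes i: "i \<in> S"
  shows "inj_on (\<lambda>j. degree (poly (x j) (monom 1 (h i)))) (S - {i})"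
    and "\<And>j. j \<in> S - {i} \<Longrightarrow> degree (poly (x j) (monom 1 (h i))) > 0"
proof -
  have ne: "h j \<noteq> h i" if "j \<in> S - {i}" for j using h i that by (auto dest: inj_onD)
  show "inj_on (\<lambda>j. degree (poly (x j) (monom 1 (h i)))) (S - {i})"
  proof (rule inj_onI)
    fix j j' assume j: "j \<in> S - {i}" "j' \<in> S - {i}"
      and "degree (poly (x j) (monom 1 (h i))) = degree (poly (x j') (monom 1 (h i)))"
    then have "h j + max (h j) (h i) = h j' + max (h j') (h i)"
      using ne by (simp add: x_def degree_poly_test_point)
    then have "h j = h j'" by linarith
    then show "j = j'" using h j by (auto dest: inj_onD)
  qed
  show "degree (poly (x j) (monom 1 (h i))) > 0" if "j \<in> S - {i}" for j
    using ne[OF that] by (simp add: x_def degree_poly_test_point max_def)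
qed

lemma subset_sum_root:
  assumes i: "i \<in> S" and w: "w \<in> subset_sums S x" and root: "poly w (monom 1 (h i)) = 0"
  shows "w = 0 \<or> w = x i"
proof -
  obtain T where T: "T \<subseteq> S" "w = sum x T" using w by (auto simp: subset_sums_def)
  have fin: "finite T" using T S finite_subset by auto
  have "poly w (monom 1 (h i)) = (\<Sum>j\<in>T. poly (x j) (monom 1 (h i)))" by (simp add: T poly_sum)
  also have "\<dots> = (\<Sum>j\<in>T - {i}. poly (x j) (monom 1 (h i)))"
    by (rule sum.mono_neutral_right) (use fin test_point_root[of i] in auto)
  finally have "(\<Sum>j\<in>T - {i}. poly (x j) (monom 1 (h i))) = 0" using root by simp
  then have "T - {i} = {}"
    using sum_distinct_degrees_nonzero[of "T - {i}" "\<lambda>j. poly (x j) (monom 1 (h i))"]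
      test_point_values[OF i] T(1) fin by (auto intro: inj_on_subset)
  then have "T = {} \<or> T = {i}" by auto
  then show ?thesis using T(2) by auto
qed

lemma test_point_independent: "inj_on (sum x) (Pow S)"
proof (rule inj_on_sum_Pow[OF char_poly(2) S])
  fix T assume T: "T \<subseteq> S" "T \<noteq> {}"
  then obtain i where i: "i \<in> T" by blast
  have fin: "finite T" using T S finite_subset by auto
  show "sum x T \<noteq> 0"
  proof
    assume 0: "sum x T = 0"
    have *: "sum x T = x i + sum x (T - {i})" using fin i by (simp add: sum.remove)
    have "sum x (T - {i}) = x i" using 0 * add_eq_0_CHAR_2[OF char_poly(2)] by metis
    have "coeff (sum x T) 1 = (\<Sum>j\<in>T. monom 1 (h j))"
      by (simp add: coeff_sum x_def test_point_def)
    moreover have "coeff (\<Sum>j\<in>T. monom (1::'a) (h j)) (h i) = (\<Sum>j\<in>T. if j = i then 1 else 0)"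
      unfolding coeff_sum by (rule sum.cong) (use T i h in \<open>auto dest: inj_onD\<close>)
    ultimately show False using 0 i fin by simp
  qed
qed

text \<open>
  Let \<open>x i\<close> be a generator outside \<open>U\<close> and evaluate at \<open>t = s\<^sup>h\<^sup>(\<^sup>i\<^sup>)\<close>.  Then \<open>c = D\<^sub>U(v)\<close> is the
  product of the elements of \<open>V - U\<close>, among which only \<open>x i\<close> vanishes there, and does so to first
  order.  On the other hand \<open>V\<close> and \<open>U\<close> have the same image under the evaluation, spanned by the
  values of the other generators, so \<open>b = c\<^sub>U\<close> specialises to \<open>\<Theta>\<close> at values of distinct degrees and
  does not vanish.
\<close>

lemma no_root_fract:
  assumes n: "card S \<ge> 2"
  defines "xF \<equiv> \<lambda>j. to_fract (x j)"
  assumes U: "fin_subgroup U" and v: "v \<in> subset_sums S xF" "v \<notin> U" and VU: "subset_sums S xF = U \<union> (+) v ` U"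
  shows "z ^ 2 + poly (subgroup_poly U) v * z + mid_coeff (subset_sums S xF) ^ 2 \<noteq> 0"
proof
  assume root: "z ^ 2 + poly (subgroup_poly U) v * z + mid_coeff (subset_sums S xF) ^ 2 = 0"
  let ?\<iota> = "to_fract :: 'a poly poly \<Rightarrow> _"
  note \<iota> = to_fract_add to_fract_mult to_fract_0 to_fract_1
  have inj: "inj_on ?\<iota> A" for A by (auto simp: inj_on_def)
  define V where "V = subset_sums S x"
  have V: "subset_sums S xF = ?\<iota> ` V" unfolding V_def xF_def by (subst subset_sums_image) auto
  have Vg: "fin_subgroup V" unfolding V_def by (rule fin_subgroup_subset_sums[OF char_poly(2) S])
  define U0 where "U0 = {u\<in>V. ?\<iota> u \<in> U}"
  have U0: "U = ?\<iota> ` U0" using VU V by (auto simp: U0_def)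
  obtain v0 where v0: "v0 \<in> V" "v = ?\<iota> v0" using v V by auto
  have v0U: "v0 \<notin> U0" using v v0 by (auto simp: U0_def)
  have U0g: "fin_subgroup U0" using Vg U unfolding fin_subgroup_def U0_def by auto
  have "?\<iota> ` V = ?\<iota> ` (U0 \<union> (+) v0 ` U0)" using VU unfolding V U0 v0(2) by (auto simp: image_Un image_image)
  then have VU0: "V = U0 \<union> (+) v0 ` U0" using inj[of UNIV] by (simp only: inj_image_eq_iff)
  have finU0: "finite U0" using U0g by (simp add: fin_subgroup_def)
  have cardV: "card V = 2 ^ card S" unfolding V_def subset_sums_def
    using test_point_independent S by (simp add: card_image card_Pow)
  have "2 * card U0 = 2 ^ card S" using card_extend[OF char_poly(2) U0g v0U VU0] cardV by simp
  moreover obtain n' where n': "card S = Suc (Suc n')" using n by (metis add_2_eq_Suc le_Suc_ex)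
  ultimately have evU0: "even (card U0)" by simp
  define c where "c = poly (subgroup_poly U0) v0"
  define b where "b = mid_coeff U0"
  have c: "poly (subgroup_poly U) v = ?\<iota> c" unfolding U0 v0(2) c_def
    by (rule poly_subgroup_poly_image[OF \<iota> inj])
  have mid: "mid_coeff (subset_sums S xF) = ?\<iota> (b ^ 2 + c)"
    using mid_coeff_image[OF \<iota> _ inj, of V] Vg mid_coeff_extend[OF char_poly(2) U0g v0U VU0 evU0]
    by (simp add: V fin_subgroup_def b_def c_def)
  obtain p r where z: "z = ?\<iota> p / ?\<iota> r" "r \<noteq> 0"
    by (cases z) (auto simp: Fract_conv_to_fract)
  have "?\<iota> (p ^ 2 + c * p * r + (b ^ 2 + c) ^ 2 * r ^ 2) = 
      (?\<iota> r) ^ 2 * (z ^ 2 + ?\<iota> c * z + (?\<iota> (b ^ 2 + c)) ^ 2)"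
    unfolding power2_eq_square to_fract_add to_fract_mult using z(2) by (simp add: z(1) field_simps)
  also have "\<dots> = 0" using root by (simp only: c mid mult_zero_right)
  finally have eq: "p ^ 2 + c * p * r + (b ^ 2 + c) ^ 2 * r ^ 2 = 0" by (simp only: to_fract_eq_0_iff)
  \<comment> \<open>Substituting \<open>z = w + b\<^sup>2\<close> makes the constant term divisible by \<open>c\<close>.\<close>
  define p1 where "p1 = p + b ^ 2 * r"
  have "p1 ^ 2 + c * p1 * r + c * (b ^ 2 + c) * r ^ 2 =
      p ^ 2 + c * p * r + (b ^ 2 + c) ^ 2 * r ^ 2 + (b ^ 2 * p * r + b ^ 2 * p * r)"
    unfolding p1_def by (simp add: power2_eq_square algebra_simps)
  also have "\<dots> = 0" by (simp only: eq add_self_CHAR_2[OF char_poly(2)] add_0)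
  finally have eq1: "p1 ^ 2 + c * p1 * r + c * (b ^ 2 + c) * r ^ 2 = 0" .
  have "\<exists>i\<in>S. x i \<notin> U0"
  proof (rule ccontr)
    assume "\<not> ?thesis"
    then have xU: "x i \<in> U0" if "i \<in> S" for i using that by blast
    have "sum x T \<in> U0" if "T \<subseteq> S" for T
      using finite_subset[OF that S] that
      by (induction T rule: finite_induct) (use U0g xU in \<open>auto simp: fin_subgroup_def\<close>)
    then have "V \<subseteq> U0" by (auto simp: V_def subset_sums_def)
    then show False using v0 v0U by blast
  qed
  then obtain i where i: "i \<in> S" "x i \<notin> U0" by blast
  define a where "a = monom (1::'a) (h i)"
  define \<phi> where "\<phi> = (\<lambda>p :: 'a poly poly. poly p a)"
  have \<phi>: "\<phi> (p + q) = \<phi> p + \<phi> q" "\<phi> (p * q) = \<phi> p * \<phi> q" "\<phi> 0 = 0" "\<phi> 1 = 1" for p q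
    by (auto simp: \<phi>_def)
  have xi: "x i \<in> V" unfolding V_def by (rule subset_sums_mem[OF i(1)])
  have root_V: "w = 0 \<or> w = x i" if "w \<in> V" "\<phi> w = 0" for w
    using subset_sum_root[OF i(1)] that by (simp add: V_def \<phi>_def a_def)
  have \<phi>xi: "\<phi> (x i) = 0" using test_point_root[of i] by (simp add: \<phi>_def a_def)
  have neg: "- w = w" for w :: "'a poly" by (rule uminus_CHAR_2[OF char_poly(1)])

  obtain u1 where u1: "u1 \<in> U0" "x i = v0 + u1" using xi i(2) VU0 by auto
  have coset: "(+) v0 ` U0 = V - U0"
  proof -
    have "v0 + u \<notin> U0" if "u \<in> U0" for u
    proof
      assume "v0 + u \<in> U0"
      then have "(v0 + u) + u \<in> U0" using that U0g unfolding fin_subgroup_def by blast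
      then show False using v0U add_self_CHAR_2[OF char_poly(2), of u] by (simp add: add.assoc)
    qed
    then show ?thesis using VU0 by blast
  qed
  \<comment> \<open>Only the factor \<open>x i\<close> of \<open>c\<close> vanishes at \<open>t = a\<close>.\<close>
  have "c = (\<Prod>u\<in>U0. v0 + u)" by (simp add: c_def poly_subgroup_poly add.commute)
  also have "\<dots> = (\<Prod>w\<in>V - U0. w)" unfolding coset[symmetric] by (subst prod.reindex) auto
  also have "\<dots> = x i * (\<Prod>w\<in>V - U0 - {x i}. w)"
    using Vg xi i(2) by (subst prod.remove[of _ "x i"]) (auto simp: fin_subgroup_def)
  finally have c_fact: "c = [:- a, 1:] * smult a (\<Prod>w\<in>V - U0 - {x i}. w)"
    by (simp add: x_def test_point_def neg smult_add_right flip: a_def)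
  moreover have "\<phi> (smult a (\<Prod>w\<in>V - U0 - {x i}. w)) \<noteq> 0"
  proof -
    have "\<phi> w \<noteq> 0" if "w \<in> V - U0 - {x i}" for w
      using root_V[of w] that U0g by (auto simp: fin_subgroup_def)
    moreover have "a \<noteq> 0" by (simp add: a_def)
    ultimately show ?thesis using Vg by (auto simp: \<phi>_def poly_prod fin_subgroup_def)
  qed
  moreover have "\<phi> (b ^ 2 + c) \<noteq> 0"
  proof -
    have inj\<phi>: "inj_on \<phi> U0"
    proof (rule inj_onI)
      fix u u' assume u: "u \<in> U0" "u' \<in> U0" "\<phi> u = \<phi> u'"
      then have "\<phi> (u + u') = 0" by (simp add: \<phi> add_self_CHAR_2[OF char_poly(1)])
      moreover have "u + u' \<in> U0" using u U0g by (auto simp: fin_subgroup_def)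
      moreover from this have "u + u' \<in> V" by (simp add: U0_def)
      ultimately have "u + u' = 0" using root_V[of "u + u'"] i(2) by metis
      then show "u = u'" by (simp add: add_eq_0_CHAR_2[OF char_poly(2)])
    qed
    let ?y = "\<lambda>j. \<phi> (x j)"
    \<comment> \<open>Each element of \<open>V\<close> differs from one of \<open>U0\<close> by \<open>0\<close> or \<open>x i\<close>, which is killed by \<open>\<phi>\<close>.\<close>
    have "\<phi> ` U0 = \<phi> ` V"
    proof
      show "\<phi> ` V \<subseteq> \<phi> ` U0"
      proof
        fix q assume "q \<in> \<phi> ` V"
        then obtain w where w: "w \<in> V" "q = \<phi> w" by blast
        show "q \<in> \<phi> ` U0"
        proof (cases "w \<in> U0")
          case False
          then obtain u where u: "u \<in> U0" "w = v0 + u" using w VU0 by auto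
          have "x i + w = (v0 + v0) + (u1 + u)" unfolding u1(2) u(2) by (simp only: add_ac)
          then have "x i + w = u1 + u" by (simp only: add_self_CHAR_2[OF char_poly(2)] add_0)
          then have "\<phi> w = \<phi> (u1 + u)" by (metis \<phi>(1) \<phi>xi add_0)
          moreover have "u1 + u \<in> U0" using u u1 U0g by (auto simp: fin_subgroup_def)
          ultimately show ?thesis using w by blast
        qed (use w in blast)
      qed
    qed (auto simp: U0_def)
    also have "\<phi> ` V = subset_sums S ?y" unfolding V_def by (rule subset_sums_image) (auto simp: \<phi>)
    also have "\<dots> = subset_sums (S - {i}) ?y"
    proof -
      have "sum ?y T = sum ?y (T - {i})" if "T \<subseteq> S" for T
        by (rule sum.mono_neutral_right) (use that S finite_subset \<phi>xi in auto)
      then have "sum ?y ` Pow S \<subseteq> sum ?y ` Pow (S - {i})"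
        by (intro image_subsetI, subst \<open>\<And>T. T \<subseteq> S \<Longrightarrow> sum ?y T = sum ?y (T - {i})\<close>) (auto intro!: imageI)
      moreover have "sum ?y ` Pow (S - {i}) \<subseteq> sum ?y ` Pow S" by (intro image_mono) auto
      ultimately show ?thesis unfolding subset_sums_def by (rule equalityI)
    qed
    finally have img: "\<phi> ` U0 = subset_sums (S - {i}) ?y" .
    have deg: "inj_on (\<lambda>j. degree (?y j)) (S - {i})" "\<And>j. j \<in> S - {i} \<Longrightarrow> degree (?y j) > 0"
      using test_point_values[OF i(1)] by (auto simp: \<phi>_def a_def)
    have cardSi: "card (S - {i}) = Suc n'" using i S n' by simp
    have "\<phi> b = mid_coeff (\<phi> ` U0)" unfolding b_def
      by (rule mid_coeff_image[symmetric]) (use \<phi> inj\<phi> finU0 in auto)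
    also have "\<dots> = two_adic_sum (S - {i}) (2 ^ (card (S - {i}) - 1)) ?y" unfolding img
    proof (rule mid_coeff_subset_sums[OF char_poly(1), where y = i])
      show "inj_on (sum ?y) (Pow (S - {i}))"
      proof (rule inj_on_sum_Pow[OF char_poly(1)])
        fix T assume T: "T \<subseteq> S - {i}" "T \<noteq> {}"
        show "sum ?y T \<noteq> 0"
        proof (rule sum_distinct_degrees_nonzero[OF _ T(2) inj_on_subset[OF deg(1) T(1)]])
          show "finite T" using T(1) S by (auto intro: finite_subset)
          show "degree (?y j) > 0" if "j \<in> T" for j using deg(2) T(1) that by blast
        qed
      qed (use S in auto)
    qed (use S cardSi in auto)
    also have "\<dots> \<noteq> 0"
    proof (rule two_adic_sum_distinct_degrees_nonzero[OF _ _ deg])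
      show "S - {i} \<noteq> {}" using cardSi by (metis card.empty nat.distinct(1))
    qed (use S in auto)
    finally have "\<phi> b \<noteq> 0" .
    moreover have "\<phi> c = 0" unfolding c_fact \<phi>_def by simp
    ultimately show ?thesis by (simp add: \<phi> power2_eq_square)
  qed
  ultimately show False
    using no_root_odd_order[of c a _ "b ^ 2 + c" r p1] z(2) eq1 unfolding \<phi>_def by blast
qed

theorem
  assumes n: "card S \<ge> 2" and y: "y \<notin> S"
  shows irreducible_two_adic_sum_test_point: "Factorial_Ring.irreducible
      (two_adic_sum (insert y S) (2 ^ card S) (\<lambda>j. if j = y then [:0, 1:] else [:to_fract (x j):]))"
    and degree_two_adic_sum_test_point: "degree
      (two_adic_sum (insert y S) (2 ^ card S) (\<lambda>j. if j = y then [:0, 1:] else [:to_fract (x j):])) = 2 ^ card S"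
proof -
  let ?P = "two_adic_sum (insert y S) (2 ^ card S) (\<lambda>j. if j = y then [:0, 1:] else [:to_fract (x j):])"
  let ?xF = "\<lambda>j. to_fract (x j)"
  have "sum ?xF T \<noteq> 0" if "T \<subseteq> S" "T \<noteq> {}" for T
  proof -
    have "sum x T \<noteq> sum x {}" using inj_onD[OF test_point_independent, of T "{}"] that by auto
    then show ?thesis unfolding to_fract_sum[symmetric] to_fract_eq_0_iff by simp
  qed
  then have inj: "inj_on (sum ?xF) (Pow S)" by (rule inj_on_sum_Pow[OF char_poly(3) S])
  have "Factorial_Ring.irreducible (subgroup_poly (subset_sums S ?xF) + [:mid_coeff (subset_sums S ?xF) ^ 2:])"
    using irreducible_subgroup_poly_plus_const[OF char_poly(3) fin_subgroup_subset_sums[OF char_poly(3) S]]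
      no_root_fract[OF n] by blast
  moreover have P: "?P = subgroup_poly (subset_sums S ?xF) + [:mid_coeff (subset_sums S ?xF) ^ 2:]"
    using two_adic_sum_eq_subgroup_poly[OF char_poly(3) S refl _ y inj] n by simp
  ultimately show "Factorial_Ring.irreducible ?P" by simp
  have "card (subset_sums S ?xF) = 2 ^ card S"
    using inj S by (simp add: subset_sums_def card_image card_Pow)
  then show "degree ?P = 2 ^ card S"
    unfolding P by (subst degree_add_eq_left) (auto simp: degree_subgroup_poly)
qed

end

section \<open>Evaluation and total degree of multivariate polynomials\<close>

definition eval_mpoly :: "('a \<Rightarrow> 'b) \<Rightarrow> ('n \<Rightarrow> 'b) \<Rightarrow> ('n::finite, 'a::zero) mpoly \<Rightarrow> 'b::comm_ring_1" where
  "eval_mpoly \<phi> x p =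
     (\<Sum>\<alpha>\<in>Poly_Mapping.keys p. \<phi> (Poly_Mapping.lookup p \<alpha>) * (\<Prod>i\<in>UNIV. x i ^ Poly_Mapping.lookup \<alpha> i))"

definition total_degree :: "('n::finite \<Rightarrow>\<^sub>0 nat) \<Rightarrow> nat" where
  "total_degree \<alpha> = (\<Sum>i\<in>UNIV. Poly_Mapping.lookup \<alpha> i)"

context
  fixes \<phi> :: "'a::comm_ring_1 \<Rightarrow> 'b::comm_ring_1" and x :: "'n::finite \<Rightarrow> 'b"
  assumes \<phi>: "\<And>a b. \<phi> (a + b) = \<phi> a + \<phi> b" "\<And>a b. \<phi> (a * b) = \<phi> a * \<phi> b" "\<phi> 0 = 0" "\<phi> 1 = 1"
begin

lemma eval_mpoly_superset:
  assumes "finite A" "Poly_Mapping.keys p \<subseteq> A"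
  shows "eval_mpoly \<phi> x p = (\<Sum>\<alpha>\<in>A. \<phi> (Poly_Mapping.lookup p \<alpha>) * (\<Prod>i\<in>UNIV. x i ^ Poly_Mapping.lookup \<alpha> i))"
  unfolding eval_mpoly_def by (rule sum.mono_neutral_left) (use assms \<phi> in \<open>auto simp: in_keys_iff\<close>)

lemma eval_mpoly_single: "eval_mpoly \<phi> x (Poly_Mapping.single \<alpha> c) = \<phi> c * (\<Prod>i\<in>UNIV. x i ^ Poly_Mapping.lookup \<alpha> i)"
  by (subst eval_mpoly_superset[of "{\<alpha>}"]) auto

lemma eval_mpoly_0: "eval_mpoly \<phi> x 0 = 0"
  by (simp add: eval_mpoly_def)

lemma eval_mpoly_1: "eval_mpoly \<phi> x 1 = 1"
  using eval_mpoly_single[of 0 1] by (simp add: \<phi>)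

lemma eval_mpoly_add: "eval_mpoly \<phi> x (p + q) = eval_mpoly \<phi> x p + eval_mpoly \<phi> x q"
proof -
  let ?A = "Poly_Mapping.keys p \<union> Poly_Mapping.keys q"
  have "Poly_Mapping.keys (p + q) \<subseteq> ?A" by (rule Poly_Mapping.keys_add)
  then show ?thesis
    by (subst (1 2 3) eval_mpoly_superset[of ?A]) (auto simp: lookup_add \<phi> distrib_right sum.distrib)
qed

lemma eval_mpoly_sum: "eval_mpoly \<phi> x (sum f A) = (\<Sum>a\<in>A. eval_mpoly \<phi> x (f a))"
  by (induction A rule: infinite_finite_induct) (auto simp: eval_mpoly_0 eval_mpoly_add)

lemma mpoly_eq_sum_single:
  fixes p :: "('n, 'a) mpoly"
  shows "p = (\<Sum>\<alpha>\<in>Poly_Mapping.keys p. Poly_Mapping.single \<alpha> (Poly_Mapping.lookup p \<alpha>))"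
proof (rule poly_mapping_eqI)
  fix \<beta>
  have "Poly_Mapping.lookup (\<Sum>\<alpha>\<in>Poly_Mapping.keys p. Poly_Mapping.single \<alpha> (Poly_Mapping.lookup p \<alpha>)) \<beta> =
      (\<Sum>\<alpha>\<in>Poly_Mapping.keys p. if \<alpha> = \<beta> then Poly_Mapping.lookup p \<alpha> else 0)"
    unfolding lookup_sum by (rule sum.cong) (auto simp: lookup_single)
  then show "Poly_Mapping.lookup p \<beta> = Poly_Mapping.lookup (\<Sum>\<alpha>\<in>Poly_Mapping.keys p. Poly_Mapping.single \<alpha> (Poly_Mapping.lookup p \<alpha>)) \<beta>"
    by (auto simp: in_keys_iff)
qed

lemma eval_mpoly_mult: "eval_mpoly \<phi> x (p * q) = eval_mpoly \<phi> x p * eval_mpoly \<phi> x q"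
proof -
  have "p * q = (\<Sum>\<alpha>\<in>Poly_Mapping.keys p. \<Sum>\<beta>\<in>Poly_Mapping.keys q.
      Poly_Mapping.single (\<alpha> + \<beta>) (Poly_Mapping.lookup p \<alpha> * Poly_Mapping.lookup q \<beta>))"
    by (subst mpoly_eq_sum_single[of p], subst mpoly_eq_sum_single[of q])
      (simp add: sum_product mult_single)
  then show ?thesis
    by (simp add: eval_mpoly_sum eval_mpoly_single \<phi> lookup_add power_add prod.distrib)
      (simp add: eval_mpoly_def sum_product mult_ac)
qed

end

lemma degree_eval_mpoly_le:
  fixes \<phi> :: "'a::comm_ring_1 \<Rightarrow> 'b::comm_ring_1 poly"
  assumes "\<And>c. degree (\<phi> c) = 0" "\<And>i. degree (x i) \<le> 1"
    and "\<And>\<alpha>. \<alpha> \<in> Poly_Mapping.keys p \<Longrightarrow> total_degree \<alpha> \<le> m"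
  shows "degree (eval_mpoly \<phi> x p) \<le> m"
  unfolding eval_mpoly_def
proof (rule degree_sum_le)
  fix \<alpha> assume a: "\<alpha> \<in> Poly_Mapping.keys p"
  have "degree (\<Prod>i\<in>UNIV. x i ^ Poly_Mapping.lookup \<alpha> i) \<le> (\<Sum>i\<in>UNIV. degree (x i ^ Poly_Mapping.lookup \<alpha> i))"
    using degree_prod_sum_le[of UNIV "\<lambda>i. x i ^ Poly_Mapping.lookup \<alpha> i"] by (simp add: comp_def)
  also have "\<dots> \<le> (\<Sum>i\<in>UNIV. 1 * Poly_Mapping.lookup \<alpha> i)"
    by (intro sum_mono order.trans[OF degree_power_le] mult_right_mono assms) auto
  also have "\<dots> \<le> m" using assms(3)[OF a] by (simp add: total_degree_def)
  finally show "degree (\<phi> (Poly_Mapping.lookup p \<alpha>) * (\<Prod>i\<in>UNIV. x i ^ Poly_Mapping.lookup \<alpha> i)) \<le> m"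
    using degree_mult_le[of "\<phi> (Poly_Mapping.lookup p \<alpha>)" "\<Prod>i\<in>UNIV. x i ^ Poly_Mapping.lookup \<alpha> i"] assms(1) by simp
qed simp

text \<open>
  Choose the weight of a new index larger than all weighted sums over the previous ones; the entry at
  the new index is then recovered by division.
\<close>

lemma separating_weights:
  assumes "finite S"
  shows "\<exists>w :: 'i \<Rightarrow> nat. \<forall>f g. (\<forall>i\<in>S. f i \<le> N \<and> g i \<le> N) \<longrightarrow>
    (\<Sum>i\<in>S. f i * w i) = (\<Sum>i\<in>S. g i * w i) \<longrightarrow> (\<forall>i\<in>S. f i = g i)"
  using assms
proof (induction S rule: finite_induct)
  case (insert y S)
  then obtain w :: "'i \<Rightarrow> nat" where w: "\<And>f g. (\<forall>i\<in>S. f i \<le> N \<and> g i \<le> N) \<Longrightarrow>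
    (\<Sum>i\<in>S. f i * w i) = (\<Sum>i\<in>S. g i * w i) \<Longrightarrow> (\<forall>i\<in>S. f i = g i)" by blast
  define W where "W = Suc (\<Sum>i\<in>S. N * w i)"
  have less: "(\<Sum>i\<in>S. f i * w i) < W" if "\<forall>i\<in>S. f i \<le> N" for f
    unfolding W_def using that by (intro le_imp_less_Suc sum_mono mult_right_mono) auto
  have split: "(\<Sum>i\<in>insert y S. f i * (w(y := W)) i) = f y * W + (\<Sum>i\<in>S. f i * w i)" for f
  proof -
    have "(\<Sum>i\<in>S. f i * (w(y := W)) i) = (\<Sum>i\<in>S. f i * w i)"
      by (rule sum.cong) (use insert.hyps in auto)
    then show ?thesis using insert.hyps by simp
  qed
  show ?case
  proof (intro exI[of _ "w(y := W)"] allI impI)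
    fix f g assume b: "\<forall>i\<in>insert y S. f i \<le> N \<and> g i \<le> N"
      and eq: "(\<Sum>i\<in>insert y S. f i * (w(y := W)) i) = (\<Sum>i\<in>insert y S. g i * (w(y := W)) i)"
    let ?F = "\<Sum>i\<in>S. f i * w i" and ?G = "\<Sum>i\<in>S. g i * w i"
    have lt: "?F < W" "?G < W" using b by (auto intro: less)
    have e: "f y * W + ?F = g y * W + ?G" using eq unfolding split .
    have "(f y * W + ?F) div W = f y" "(g y * W + ?G) div W = g y"
      using lt by (simp_all add: div_mult_self3)
    then have "f y = g y" using e by metis
    moreover from this have "?F = ?G" using e by simp
    then have "\<forall>i\<in>S. f i = g i" using w b by blast
    ultimately show "\<forall>i\<in>insert y S. f i = g i" by blast
  qed
qed simp

text \<open>
  Kronecker substitution \<open>X\<^sub>i \<mapsto> u\<^sup>w\<^sup>(\<^sup>i\<^sup>) \<tau>\<close> with weights that separate the monomials of \<open>p\<close> and \<open>q\<close>.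
  The \<open>\<tau>\<close>-degree of the image is then the total degree, and degrees add up in \<open>K[u][\<tau>]\<close>.
\<close>

lemma total_degree_factors:
  fixes p q :: "('n::finite, 'a::idom) mpoly"
  assumes pq: "\<And>\<gamma>. \<gamma> \<in> Poly_Mapping.keys (p * q) \<Longrightarrow> total_degree \<gamma> \<le> m"
    and \<alpha>: "\<alpha> \<in> Poly_Mapping.keys p" and \<beta>: "\<beta> \<in> Poly_Mapping.keys q"
  shows "total_degree \<alpha> + total_degree \<beta> \<le> m"
proof -
  let ?E = "\<Union>\<gamma>\<in>Poly_Mapping.keys p \<union> Poly_Mapping.keys q. range (Poly_Mapping.lookup \<gamma>)"
  define N where "N = Max ?E"
  have N: "Poly_Mapping.lookup \<gamma> i \<le> N" if "\<gamma> \<in> Poly_Mapping.keys p \<union> Poly_Mapping.keys q" for \<gamma> i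
    unfolding N_def by (rule Max_ge) (use that in auto)
  obtain w :: "'n \<Rightarrow> nat" where w: "\<And>f g. (\<forall>i. f i \<le> N \<and> g i \<le> N) \<Longrightarrow>
      (\<Sum>i\<in>UNIV. f i * w i) = (\<Sum>i\<in>UNIV. g i * w i) \<Longrightarrow> (\<forall>i. f i = g i)"
    using separating_weights[of "UNIV :: 'n set" N] by auto
  define \<phi> :: "'a \<Rightarrow> 'a poly poly" where "\<phi> = (\<lambda>c. [:[:c:]:])"
  have \<phi>: "\<phi> (a + b) = \<phi> a + \<phi> b" "\<phi> (a * b) = \<phi> a * \<phi> b" "\<phi> 0 = 0" "\<phi> 1 = 1" "degree (\<phi> a) = 0" for a b
    by (simp_all add: \<phi>_def one_pCons)
  define x :: "'n \<Rightarrow> 'a poly poly" where "x = (\<lambda>i. monom (monom 1 (w i)) 1)"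
  have xdeg: "degree (x i) \<le> 1" for i by (simp add: x_def degree_monom_le)
  define wt where "wt = (\<lambda>\<gamma> :: 'n \<Rightarrow>\<^sub>0 nat. \<Sum>i\<in>UNIV. Poly_Mapping.lookup \<gamma> i * w i)"
  have eval_term: "\<phi> c * (\<Prod>i\<in>UNIV. x i ^ Poly_Mapping.lookup \<gamma> i) = monom (monom c (wt \<gamma>)) (total_degree \<gamma>)" for c \<gamma>
  proof -
    have "(\<Prod>i\<in>I. x i ^ Poly_Mapping.lookup \<gamma> i) = monom (monom 1 (\<Sum>i\<in>I. Poly_Mapping.lookup \<gamma> i * w i)) (\<Sum>i\<in>I. Poly_Mapping.lookup \<gamma> i)" for I
      by (induction I rule: infinite_finite_induct) (simp_all add: x_def monom_power mult_monom mult.commute monom_0 one_pCons)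
    then show ?thesis by (simp add: \<phi>_def wt_def total_degree_def smult_monom)
  qed
  have coeff_eval: "coeff (coeff (eval_mpoly \<phi> x r) (total_degree \<gamma>)) (wt \<gamma>) = Poly_Mapping.lookup r \<gamma>"
    if \<gamma>: "\<gamma> \<in> Poly_Mapping.keys r" and r: "\<And>\<gamma> i. \<gamma> \<in> Poly_Mapping.keys r \<Longrightarrow> Poly_Mapping.lookup \<gamma> i \<le> N" for r \<gamma>
  proof -
    have "coeff (coeff (eval_mpoly \<phi> x r) (total_degree \<gamma>)) (wt \<gamma>) =
        (\<Sum>\<delta>\<in>Poly_Mapping.keys r. if \<delta> = \<gamma> then Poly_Mapping.lookup r \<delta> else 0)"
      unfolding eval_mpoly_def eval_term coeff_sum
    proof (rule sum.cong[OF refl])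
      fix \<delta> assume \<delta>: "\<delta> \<in> Poly_Mapping.keys r"
      have "\<delta> = \<gamma>" if "wt \<delta> = wt \<gamma>"
      proof (rule poly_mapping_eqI)
        have "\<forall>i. Poly_Mapping.lookup \<delta> i \<le> N \<and> Poly_Mapping.lookup \<gamma> i \<le> N" using r \<gamma> \<delta> by simp
        from w[OF this that[unfolded wt_def]]
        show "Poly_Mapping.lookup \<delta> i = Poly_Mapping.lookup \<gamma> i" for i by (rule spec)
      qed
      then show "coeff (coeff (monom (monom (Poly_Mapping.lookup r \<delta>) (wt \<delta>)) (total_degree \<delta>)) (total_degree \<gamma>)) (wt \<gamma>) =
          (if \<delta> = \<gamma> then Poly_Mapping.lookup r \<delta> else 0)" by auto
    qed
    then show ?thesis using \<gamma> by simp
  qed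
  have deg_ge: "total_degree \<gamma> \<le> degree (eval_mpoly \<phi> x r)" "eval_mpoly \<phi> x r \<noteq> 0"
    if \<gamma>: "\<gamma> \<in> Poly_Mapping.keys r" and r: "\<And>\<gamma> i. \<gamma> \<in> Poly_Mapping.keys r \<Longrightarrow> Poly_Mapping.lookup \<gamma> i \<le> N" for r \<gamma>
  proof -
    have "coeff (eval_mpoly \<phi> x r) (total_degree \<gamma>) \<noteq> 0"
      using coeff_eval[OF that] \<gamma> by (auto simp: in_keys_iff)
    then show "total_degree \<gamma> \<le> degree (eval_mpoly \<phi> x r)" "eval_mpoly \<phi> x r \<noteq> 0"
      by (auto intro: le_degree)
  qed
  have "total_degree \<alpha> + total_degree \<beta> \<le> degree (eval_mpoly \<phi> x p) + degree (eval_mpoly \<phi> x q)"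
    using deg_ge(1)[OF \<alpha>] deg_ge(1)[OF \<beta>] N by (intro add_mono) auto
  also have "\<dots> = degree (eval_mpoly \<phi> x (p * q))"
    using deg_ge(2)[OF \<alpha>] deg_ge(2)[OF \<beta>] N
    by (subst eval_mpoly_mult) (auto simp: \<phi>(1-4) degree_mult_eq)
  also have "\<dots> \<le> m" by (rule degree_eval_mpoly_le) (use \<phi>(5) xdeg pq in auto)
  finally show ?thesis .
qed

text \<open>
  An exponent vector is a padded permutation of exactly one multiset without 0, its multiset \<open>\<rho>\<close> of
  non-zero entries.  Hence each monomial with admissible exponents occurs once in the double sum.
\<close>

lemma lookup_Theta:
  "Poly_Mapping.lookup (Theta :: ('n::finite, bit) mpoly) \<alpha> =
     (if Poly_Mapping.lookup \<alpha> \<in> exponents UNIV (2 ^ (CARD('n) - 1)) then 1 else 0)"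
proof -
  let ?k = "CARD('n)"
  let ?M = "image_mset (Poly_Mapping.lookup \<alpha>) (mset_set UNIV)"
  define \<rho> where "\<rho> = filter_mset (\<lambda>e. e \<noteq> 0) ?M"
  have unique: "\<sigma> = \<rho>" if "\<sigma> \<in> Lambda ?k" "\<alpha> \<in> perms_padded \<sigma>" for \<sigma>
  proof -
    have "?M = \<sigma> + replicate_mset (?k - size \<sigma>) 0" using that(2) by (simp add: perms_padded_def)
    then have "\<rho> = filter_mset (\<lambda>e. e \<noteq> 0) \<sigma>" unfolding \<rho>_def by simp
    also have "\<dots> = \<sigma>" using that(1) by (intro filter_mset_eq_conv[THEN iffD2]) (auto simp: Lambda_def is_partition_def intro: gr0I)
    finally show ?thesis by simp
  qed
  have sizeM: "size ?M = ?k" by simp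
  have M: "?M = \<rho> + replicate_mset (count ?M 0) 0"
  proof -
    have "?M = \<rho> + filter_mset (\<lambda>e. \<not> e \<noteq> 0) ?M" unfolding \<rho>_def by (rule multiset_partition)
    also have "filter_mset (\<lambda>e. \<not> e \<noteq> 0) ?M = replicate_mset (count ?M 0) 0"
      using filter_eq_replicate_mset[of 0 ?M] by (simp add: eq_commute)
    finally show ?thesis .
  qed
  have size: "size \<rho> \<le> ?k" "count ?M 0 = ?k - size \<rho>"
    using arg_cong[OF M, of size] sizeM by auto
  have perms: "\<alpha> \<in> perms_padded \<rho>" using M size by (simp add: perms_padded_def)
  have "sum_mset \<rho> = sum_mset ?M" using arg_cong[OF M, of sum_mset] by simp
  also have "\<dots> = sum (Poly_Mapping.lookup \<alpha>) UNIV" by (simp add: sum_unfold_sum_mset)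
  finally have sum: "sum_mset \<rho> = sum (Poly_Mapping.lookup \<alpha>) UNIV" .
  have in_\<rho>: "e \<in># \<rho> \<longleftrightarrow> e \<noteq> 0 \<and> e \<in> range (Poly_Mapping.lookup \<alpha>)" for e
    by (auto simp: \<rho>_def)
  have zp: "e \<in> zero_or_power2 \<longleftrightarrow> e = 0 \<or> (\<exists>i. e = 2 ^ i)" for e by (auto simp: zero_or_power2_def)
  have "two_adic \<rho> \<longleftrightarrow> (\<forall>j. Poly_Mapping.lookup \<alpha> j \<in> zero_or_power2)"
  proof
    assume two: "two_adic \<rho>"
    show "\<forall>j. Poly_Mapping.lookup \<alpha> j \<in> zero_or_power2"
    proof
      fix j
      show "Poly_Mapping.lookup \<alpha> j \<in> zero_or_power2"
      proof (cases "Poly_Mapping.lookup \<alpha> j = 0")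
        case False
        then have "Poly_Mapping.lookup \<alpha> j \<in># \<rho>" unfolding in_\<rho> by simp
        then have "\<exists>i. Poly_Mapping.lookup \<alpha> j = 2 ^ i" using two unfolding two_adic_def by (rule bspec[rotated])
        then show ?thesis unfolding zp by (rule disjI2)
      qed (simp add: zp)
    qed
  next
    assume all: "\<forall>j. Poly_Mapping.lookup \<alpha> j \<in> zero_or_power2"
    show "two_adic \<rho>" unfolding two_adic_def
    proof
      fix p assume "p \<in># \<rho>"
      then have p: "p \<noteq> 0" "p \<in> range (Poly_Mapping.lookup \<alpha>)" unfolding in_\<rho> by (rule conjunct1, rule conjunct2)
      from p(2) have "p \<in> zero_or_power2" by (rule rangeE) (simp add: all)
      then have "p = 0 \<or> (\<exists>i. p = 2 ^ i)" unfolding zp .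
      then show "\<exists>i. p = 2 ^ i" using p(1) by (elim disjE) (erule notE, assumption+)
    qed
  qed
  moreover have "0 \<notin># \<rho>" using in_\<rho>[of 0] by simp
  ultimately have mem: "\<rho> \<in> Lambda ?k \<longleftrightarrow> Poly_Mapping.lookup \<alpha> \<in> exponents UNIV (2 ^ (?k - 1))"
    using size(1) sum by (simp add: Lambda_def is_partition_def exponents_def conj_commute)
  have "Poly_Mapping.lookup (Theta :: ('n, bit) mpoly) \<alpha> =
      (\<Sum>\<sigma>\<in>Lambda ?k. \<Sum>\<beta>\<in>perms_padded \<sigma>. if \<beta> = \<alpha> then 1 else 0)"
    unfolding Theta_def monomial_symmetric_def lookup_sum
    by (intro sum.cong refl) (auto simp: lookup_single)
  also have "\<dots> = (\<Sum>\<sigma>\<in>Lambda ?k. if \<alpha> \<in> perms_padded \<sigma> then 1 else 0)"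
    by (intro sum.cong refl) (simp add: finite_perms_padded)
  also have "\<dots> = (\<Sum>\<sigma>\<in>Lambda ?k. if \<sigma> = \<rho> then 1 else 0)"
  proof (rule sum.cong[OF refl])
    fix \<sigma> assume "\<sigma> \<in> Lambda ?k"
    then have "\<alpha> \<in> perms_padded \<sigma> \<longleftrightarrow> \<sigma> = \<rho>" using unique[of \<sigma>] perms by metis
    then show "(if \<alpha> \<in> perms_padded \<sigma> then 1 else 0 :: bit) = (if \<sigma> = \<rho> then 1 else 0)" by (simp only:)
  qed
  also have "\<dots> = (if \<rho> \<in> Lambda ?k then 1 else 0)" by (simp add: finite_Lambda)
  finally show ?thesis by (simp only: mem)
qed

lemma eval_mpoly_Theta:
  fixes \<phi> :: "bit alg_closure \<Rightarrow> 'b::comm_ring_1" and x :: "'n::finite \<Rightarrow> 'b"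
  assumes "\<phi> 1 = 1"
  shows "eval_mpoly \<phi> x (Poly_Mapping.map to_ac (Theta :: ('n, bit) mpoly)) = two_adic_sum UNIV (2 ^ (CARD('n) - 1)) x"
proof -
  let ?T = "Poly_Mapping.map to_ac (Theta :: ('n, bit) mpoly)"
  let ?E = "exponents (UNIV :: 'n set) (2 ^ (CARD('n) - 1))"
  have look: "Poly_Mapping.lookup ?T \<alpha> = (if Poly_Mapping.lookup \<alpha> \<in> ?E then 1 else 0)" for \<alpha>
    by (simp add: Poly_Mapping.map.rep_eq lookup_Theta when_def)
  show ?thesis unfolding eval_mpoly_def two_adic_sum_def
    by (rule sum.reindex_bij_witness[where i = Abs_poly_mapping and j = Poly_Mapping.lookup])
      (simp_all add: in_keys_iff look assms split: if_splits)
qed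

lemma total_degree_Theta:
  assumes "\<alpha> \<in> Poly_Mapping.keys (Poly_Mapping.map to_ac (Theta :: ('n::finite, bit) mpoly))"
  shows "total_degree \<alpha> = 2 ^ (CARD('n) - 1)"
proof -
  have "Poly_Mapping.lookup \<alpha> \<in> exponents UNIV (2 ^ (CARD('n) - 1))"
  proof (rule ccontr)
    assume "\<not> ?thesis"
    then have "Poly_Mapping.lookup (Theta :: ('n, bit) mpoly) \<alpha> = 0" unfolding lookup_Theta by (rule if_not_P)
    then show False using assms unfolding in_keys_iff Poly_Mapping.map.rep_eq by simp
  qed
  then show ?thesis by (simp add: exponents_def total_degree_def)
qed

section \<open>Absolute irreducibility\<close>

lemma mpoly_unit_if_total_degree_0:
  fixes f :: "('n::finite, 'a::field) mpoly"
  assumes "f \<noteq> 0" "\<And>\<alpha>. \<alpha> \<in> Poly_Mapping.keys f \<Longrightarrow> total_degree \<alpha> = 0"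
  shows "f dvd 1"
proof -
  have "\<alpha> = 0" if "\<alpha> \<in> Poly_Mapping.keys f" for \<alpha>
    using assms(2)[OF that] by (intro poly_mapping_eqI) (simp add: total_degree_def)
  then have keys: "Poly_Mapping.keys f \<subseteq> {0}" by blast
  have f: "f = Poly_Mapping.single 0 (Poly_Mapping.lookup f 0)"
    by (rule poly_mapping_eqI) (use keys in \<open>auto simp: lookup_single when_def in_keys_iff\<close>)
  have "Poly_Mapping.lookup f 0 \<noteq> 0" using f assms(1) by (metis single_zero)
  then have "f * Poly_Mapping.single 0 (inverse (Poly_Mapping.lookup f 0)) = 1"
    by (subst f) (simp add: mult_single)
  then show ?thesis by (metis dvd_triv_left)
qed

lemma CHAR_bit: "CHAR(bit) = 2"
proof -
  have "of_nat 2 = (0 :: bit)" by (simp add: numeral_2_eq_2)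
  then have "CHAR(bit) dvd 2" by (simp only: of_nat_eq_0_iff_char_dvd)
  then show ?thesis using CHAR_not_1[where 'a = bit] by (metis One_nat_def dvd_antisym prime_nat_iff two_is_prime_nat)
qed

theorem theorem4p3:
  assumes "CARD('n::finite) \<ge> 3"
  shows "absolutely_irreducible (Theta :: ('n, bit) mpoly)"
proof -
  let ?\<Theta> = "Poly_Mapping.map to_ac (Theta :: ('n, bit) mpoly)"
  have char: "CHAR(bit alg_closure) = 2" by (simp add: CHAR_bit)
  obtain h :: "'n \<Rightarrow> nat" where h: "inj h"
    using finite_imp_inj_to_nat_seg[of "UNIV :: 'n set"] by auto
  obtain y :: 'n where True by blast
  define S where "S = UNIV - {y}"
  have S: "finite S" "y \<notin> S" "insert y S = UNIV" "card S = CARD('n) - 1"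
    by (auto simp: S_def card_Diff_singleton)
  define \<phi> where "\<phi> = (\<lambda>c :: bit alg_closure. [:to_fract [:[:c:]:]:])"
  have \<phi>: "\<phi> (a + b) = \<phi> a + \<phi> b" "\<phi> (a * b) = \<phi> a * \<phi> b" "\<phi> 0 = 0" "\<phi> 1 = 1" "degree (\<phi> a) = 0" for a b
    by (simp_all add: \<phi>_def flip: to_fract_add to_fract_mult one_pCons)
  define x where "x = (\<lambda>j :: 'n. if j = y then [:0, 1:] else [:to_fract (test_point h j :: bit alg_closure poly poly):])"
  have x: "degree (x i) \<le> 1" for i by (simp add: x_def)
  let ?ev = "eval_mpoly \<phi> x"
  note ev = eval_mpoly_mult[of \<phi>, OF \<phi>(1-4)] eval_mpoly_1[of \<phi>, OF \<phi>(1-4)]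
  define P where "P = two_adic_sum UNIV (2 ^ (CARD('n) - 1)) x"
  have "Factorial_Ring.irreducible (two_adic_sum (insert y S) (2 ^ card S) x)"
    unfolding x_def by (rule irreducible_two_adic_sum_test_point[OF char S(1)])
      (use h assms S in \<open>auto intro: inj_on_subset\<close>)
  then have P: "Factorial_Ring.irreducible P" unfolding P_def by (simp only: S(3,4))
  have ev\<Theta>: "?ev ?\<Theta> = P" unfolding P_def by (rule eval_mpoly_Theta) (rule \<phi>(4))
  define m :: nat where "m = 2 ^ (CARD('n) - 1)"
  have "degree (two_adic_sum (insert y S) (2 ^ card S) x) = 2 ^ card S"
    unfolding x_def by (rule degree_two_adic_sum_test_point[OF char S(1)])
      (use h assms S in \<open>auto intro: inj_on_subset\<close>)
  then have degP: "m \<le> degree P" unfolding P_def m_def by (simp only: S(3,4))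
  \<comment> \<open>The \<open>Y\<close>-degree of the image of \<open>g\<close> accounts for the whole total degree \<open>m\<close> of the product and
    leaves nothing for \<open>f\<close>.\<close>
  have unit: "f dvd 1" if fg: "?\<Theta> = f * g" and u: "?ev f dvd 1" for f g
  proof (rule mpoly_unit_if_total_degree_0)
    have P_fg: "P = ?ev f * ?ev g" by (simp only: ev\<Theta>[symmetric] fg ev)
    have nz: "?ev f \<noteq> 0" "?ev g \<noteq> 0" using P P_fg by (auto simp: irreducible_def)
    show "f \<noteq> 0" using nz by (auto simp: eval_mpoly_def)
    fix \<alpha> assume \<alpha>: "\<alpha> \<in> Poly_Mapping.keys f"
    have "degree (?ev f) = 0" using u nz by (simp add: is_unit_iff_degree)
    then have "m \<le> degree (?ev g)" using degP P_fg nz by (simp add: degree_mult_eq)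
    have "total_degree \<alpha> + degree (?ev g) \<le> m"
    proof (cases "total_degree \<alpha> \<le> m")
      case True
      have "degree (?ev g) \<le> m - total_degree \<alpha>"
      proof (rule degree_eval_mpoly_le)
        fix \<beta> assume "\<beta> \<in> Poly_Mapping.keys g"
        then have "total_degree \<alpha> + total_degree \<beta> \<le> m"
          by (intro total_degree_factors[OF _ \<alpha>]) (auto simp: m_def total_degree_Theta simp flip: fg)
        then show "total_degree \<beta> \<le> m - total_degree \<alpha>" by simp
      qed (use \<phi>(5) x in auto)
      then show ?thesis using True by simp
    next
      case False
      have "Poly_Mapping.keys g \<noteq> {}" using nz(2) by (intro notI) (simp add: eval_mpoly_def)
      then obtain \<beta> where "\<beta> \<in> Poly_Mapping.keys g" by blast
      then have "total_degree \<alpha> + total_degree \<beta> \<le> m"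
        by (intro total_degree_factors[OF _ \<alpha>]) (auto simp: m_def total_degree_Theta simp flip: fg)
      then show ?thesis using False by simp
    qed
    then show "total_degree \<alpha> = 0" using \<open>m \<le> degree (?ev g)\<close> by simp
  qed
  show ?thesis unfolding absolutely_irreducible_def
  proof (rule irreducibleI)
    show "?\<Theta> \<noteq> 0" using ev\<Theta> P by (auto simp: eval_mpoly_def irreducible_def)
    show "\<not> ?\<Theta> dvd 1"
    proof
      assume "?\<Theta> dvd 1"
      then obtain g where "1 = ?\<Theta> * g" by (elim dvdE)
      then have "1 = P * ?ev g" using ev ev\<Theta> by metis
      then show False using P by (metis dvdI irreducible_not_unit)
    qed
    fix f g assume fg: "?\<Theta> = f * g"
    have "P = ?ev f * ?ev g" by (simp only: ev\<Theta>[symmetric] fg ev)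
    then have "?ev f dvd 1 \<or> ?ev g dvd 1" by (rule irreducibleD[OF P])
    then show "f dvd 1 \<or> g dvd 1" using unit[OF fg] unit[of g f] fg by (auto simp: mult.commute)
  qed
qed

end
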